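(* Let $G$ be a simple, connected, non-bipartite graph with edge ideal $I_G$. Then $$\mathrm{dstab}(I_G)\le \tfrac12\big(\mathrm{card}(E(G))+\psi(G)\big)+1,$$ $$\mathrm{astab}(I_G)\le \mathrm{card}(E(G))-k+1,$$ where $2k-1$ is the minimum length of an odd cycle in $G$.
   Context: Graphs are finite. Write $V=\{P_1,\dots,P_d\}$ for the vertex set of $G$, $E(G)$ for its edge set, and $R=K[x_1,\dots,x_d]$ with $K$ a field. The edge ideal of $G$ is $I_G=(x_ix_j : P_iP_j\in E(G))\subset R$. $\mathrm{Ass}(J)$ is the set of associated primes of $R/J$. $\mathrm{astab}(I_G)$ is the smallest $k\ge1$ such that $\mathrm{Ass}(I_G^k)=\mathrm{Ass}(I_G^{k+i})$ for all $i\ge 0$; $\mathrm{dstab}(I_G)$ is the smallest $k$ such that the maximal ideal $(x_1,\dots,x_d)$ belongs to $\mathrm{Ass}(I_G^k)$. $\psi(G)$ is the number of bridges of $G$. *)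

theory Defs
  imports
    "HOL-Algebra.Ideal_Product"
    "HOL-Algebra.QuotRing"
    "HOL-Algebra.Algebraic_Closure_Type"
    "HOL-Library.Poly_Mapping"
    "HOL-Library.Extended_Nat"
    "HOL-Library.Extended_Real"
begin

section \<open>Graphs\<close>

text \<open>
  A graph is given by its set of edges; its vertex set is the whole of the finite type \<open>'v\<close>.
\<close>

definition simple_graph :: "'v::finite set set \<Rightarrow> bool" where
  "simple_graph E \<longleftrightarrow> (\<forall>e\<in>E. card e = 2)"

definition adj :: "'v::finite set set \<Rightarrow> ('v \<times> 'v) set" where
  "adj E = {(u, v). {u, v} \<in> E}"

definition components :: "'v::finite set set \<Rightarrow> 'v set set" where
  "components E = UNIV // (adj E)\<^sup>*"

definition connected_graph :: "'v::finite set set \<Rightarrow> bool" where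
  "connected_graph E \<longleftrightarrow> (\<forall>u v. (u, v) \<in> (adj E)\<^sup>*)"

definition bipartite :: "'v::finite set set \<Rightarrow> bool" where
  "bipartite E \<longleftrightarrow> (\<exists>A B. A \<union> B = UNIV \<and> A \<inter> B = {} \<and>
     (\<forall>e\<in>E. \<exists>a\<in>A. \<exists>b\<in>B. e = {a, b}))"

definition bridges :: "'v::finite set set \<Rightarrow> 'v set set" where
  "bridges E = {e \<in> E. card (components (E - {e})) > card (components E)}"

definition num_bridges :: "'v::finite set set \<Rightarrow> nat" where
  "num_bridges E = card (bridges E)"

text \<open>A cycle is represented by the list of its vertices, so its length is the length of the list.\<close>

definition is_cycle :: "'v::finite set set \<Rightarrow> 'v list \<Rightarrow> bool" where
  "is_cycle E c \<longleftrightarrow> 3 \<le> length c \<and> distinct c \<and>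
     (\<forall>i<length c. {c ! i, c ! (Suc i mod length c)} \<in> E)"

text \<open>The minimum length of an odd cycle; unspecified if there is no odd cycle.\<close>

definition odd_girth :: "'v::finite set set \<Rightarrow> nat" where
  "odd_girth E = (LEAST n. odd n \<and> (\<exists>c. is_cycle E c \<and> length c = n))"


section \<open>Associated primes\<close>

text \<open>
  The prime ideals of \<open>R\<close> that are annihilators of elements of the \<open>R\<close>-module \<open>R/J\<close>,
  where \<open>r\<close> acts on \<open>R/J\<close> as multiplication by its residue class.
\<close>

definition Ass :: "('a, 'b) ring_scheme \<Rightarrow> 'a set \<Rightarrow> 'a set set" where
  "Ass R J = {P. primeideal P R \<and>
     (\<exists>m\<in>carrier (R Quot J).
        P = {r \<in> carrier R. (J +>\<^bsub>R\<^esub> r) \<otimes>\<^bsub>R Quot J\<^esub> m = \<zero>\<^bsub>R Quot J\<^esub>})}"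

definition ideal_pow :: "('a, 'b) ring_scheme \<Rightarrow> 'a set \<Rightarrow> nat \<Rightarrow> 'a set" where
  "ideal_pow R I n = I [^]\<^bsub>ideals_set R\<^esub> n"


section \<open>Edge ideals\<close>

text \<open>
  Polynomials over \<open>'k\<close> in one variable for each element of \<open>'v\<close>: finitely supported
  functions from exponent vectors to coefficients, multiplied by convolution.
\<close>

type_synonym ('v, 'k) mpoly = "('v \<Rightarrow>\<^sub>0 nat) \<Rightarrow>\<^sub>0 'k"

definition Var :: "'v \<Rightarrow> ('v, 'k::field) mpoly" where
  "Var v = Poly_Mapping.single (Poly_Mapping.single v 1) 1"

definition mpoly_ring :: "('v, 'k::field) mpoly ring" where
  "mpoly_ring = ring_of_type_algebra"

definition edge_ideal :: "'v::finite set set \<Rightarrow> ('v, 'k::field) mpoly set" where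
  "edge_ideal E = Idl\<^bsub>mpoly_ring\<^esub> {Var u * Var v | u v. {u, v} \<in> E}"

definition max_ideal :: "('v::finite, 'k::field) mpoly set" where
  "max_ideal = Idl\<^bsub>mpoly_ring\<^esub> (range Var)"

text \<open>Both indices are \<open>\<infinity>\<close> if there is no exponent with the required property.\<close>

definition astab :: "('v::finite, 'k::field) mpoly set \<Rightarrow> enat" where
  "astab I = Inf (enat ` {k. 1 \<le> k \<and>
     (\<forall>i. Ass mpoly_ring (ideal_pow mpoly_ring I k) = Ass mpoly_ring (ideal_pow mpoly_ring I (k + i)))})"

definition dstab :: "('v::finite, 'k::field) mpoly set \<Rightarrow> enat" where
  "dstab I = Inf (enat ` {k. 1 \<le> k \<and> max_ideal \<in> Ass mpoly_ring (ideal_pow mpoly_ring I k)})"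

end

theory Submission
  imports Defs
begin

text \<open>
  A monomial \<open>x\<^sup>a\<close> lies in the \<open>n\<close>-th power of the edge ideal iff \<open>a\<close> dominates the degree sequence of a
  multiset of \<open>n\<close> edges, and every associated prime is the annihilator of a monomial. So
  \<open>(x\<^sub>v : v \<in> C)\<close> is associated to the \<open>n\<close>-th power iff there is a vector \<open>a\<close> that holds no \<open>n\<close> edges, even
  after arbitrary increases outside \<open>C\<close>, but does so after an increase at any vertex of \<open>C\<close>.

  If this happens for some \<open>n\<close>, then the complement of \<open>C\<close> is independent and the graph induced on the
  vertices of \<open>C\<close> without neighbours outside \<open>C\<close> has no bipartite component. Conversely, a connected
  non-bipartite graph carries vectors of weight \<open>2T + 1\<close> which become degree sequences of \<open>T\<close> edges when
  lowered at any vertex: start from an odd cycle and attach ears. An ear with \<open>l\<close> edges raises \<open>T\<close> by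
  at most \<open>l / 2\<close>, a bridge raises it by \<open>1\<close>; this gives the bound on \<open>dstab\<close>. Attaching single edges
  to an odd cycle of length at least \<open>2k - 1\<close> in each component gives every \<open>T \<ge> card E - k\<close>, so that
  all primes which are associated to some power are associated to all powers with exponent at
  least \<open>card E - k + 1\<close>.
\<close>

section \<open>Monomial ideals and their associated primes\<close>

abbreviation "lookup \<equiv> Poly_Mapping.lookup"
abbreviation "keys \<equiv> Poly_Mapping.keys"
abbreviation "single \<equiv> Poly_Mapping.single"
abbreviation xpow :: "('v \<Rightarrow>\<^sub>0 nat) \<Rightarrow> ('v, 'k::field) mpoly" where
  "xpow u \<equiv> single u 1"

section \<open>The polynomial ring and annihilators modulo an ideal\<close>

lemma mpoly_ring_simps [simp]:
  "carrier mpoly_ring = UNIV"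
  "monoid.mult mpoly_ring = (*)"
  "monoid.one mpoly_ring = 1"
  "ring.zero mpoly_ring = 0"
  "ring.add mpoly_ring = (+)"
  by (auto simp: mpoly_ring_def ring_of_type_algebra_def)

lemma cring_mpoly: "cring mpoly_ring"
  unfolding mpoly_ring_def by (rule cring_from_type_algebra)

lemma ideal_mpolyI:
  assumes "0 \<in> I" "\<And>f g. f \<in> I \<Longrightarrow> g \<in> I \<Longrightarrow> f + g \<in> I" "\<And>f g. f \<in> I \<Longrightarrow> g * f \<in> I"
  shows "ideal I (mpoly_ring :: ('v, 'k::field) mpoly ring)"
proof -
  interpret cring "mpoly_ring :: ('v, 'k) mpoly ring" by (rule cring_mpoly)
  show ?thesis
  proof (rule idealI)
    show "ring (mpoly_ring :: ('v, 'k) mpoly ring)" by (rule ring_axioms)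
    show "subgroup I (add_monoid (mpoly_ring :: ('v, 'k) mpoly ring))"
    proof (rule add.subgroupI)
      fix a assume "a \<in> I"
      then have "- 1 * a \<in> I" by (rule assms(3))
      moreover have "\<ominus>\<^bsub>mpoly_ring\<^esub> a = - a" by (rule minus_equality) auto
      ultimately show "\<ominus>\<^bsub>mpoly_ring\<^esub> a \<in> I" by simp
    qed (use assms in auto)
  qed (use assms in \<open>auto simp: mult.commute\<close>)
qed

lemma ideal_mpolyD:
  assumes "ideal I (mpoly_ring :: ('v, 'k::field) mpoly ring)"
  shows "0 \<in> I" "f \<in> I \<Longrightarrow> g \<in> I \<Longrightarrow> f + g \<in> I" "f \<in> I \<Longrightarrow> g * f \<in> I"
    "f \<in> I \<Longrightarrow> g \<in> I \<Longrightarrow> f - g \<in> I"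
proof -
  interpret ideal I "mpoly_ring :: ('v, 'k) mpoly ring" by (rule assms)
  show 0: "0 \<in> I" using additive_subgroup.zero_closed[OF additive_subgroup_axioms] by simp
  show add: "f \<in> I \<Longrightarrow> g \<in> I \<Longrightarrow> f + g \<in> I" for f g
    using additive_subgroup.a_closed[OF additive_subgroup_axioms] by simp
  show mult: "f \<in> I \<Longrightarrow> g * f \<in> I" for f g using I_l_closed by simp
  show "f \<in> I \<Longrightarrow> g \<in> I \<Longrightarrow> f - g \<in> I"
    using add[of f "- 1 * g"] mult[of g "- 1"] by simp
qed

text \<open>Every element of R/J is the class of some polynomial f, and its annihilator is the colon
  ideal J : f. This removes the quotient ring from all later arguments.\<close>

lemma Ass_mpoly:
  assumes J: "ideal J (mpoly_ring :: ('v, 'k::field) mpoly ring)"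
  shows "Ass mpoly_ring J = {P. primeideal P mpoly_ring \<and> (\<exists>f. P = {r. r * f \<in> J})}"
proof -
  interpret R: cring "mpoly_ring :: ('v, 'k) mpoly ring" by (rule cring_mpoly)
  interpret ideal J "mpoly_ring :: ('v, 'k) mpoly ring" by (rule J)
  have carr: "carrier (mpoly_ring Quot J) = range (\<lambda>f. J +>\<^bsub>mpoly_ring\<^esub> f)"
    by (auto simp: FactRing_def A_RCOSETS_def')
  have mult: "(J +>\<^bsub>mpoly_ring\<^esub> r) \<otimes>\<^bsub>mpoly_ring Quot J\<^esub> (J +>\<^bsub>mpoly_ring\<^esub> f) = J +>\<^bsub>mpoly_ring\<^esub> (r * f)" for r f
    using rcoset_mult_add[of r f] by (simp add: FactRing_def)
  have zero: "J +>\<^bsub>mpoly_ring\<^esub> r = \<zero>\<^bsub>mpoly_ring Quot J\<^esub> \<longleftrightarrow> r \<in> J" for r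
    using a_rcos_const a_rcos_self by (force simp: FactRing_def)
  have "{r \<in> carrier mpoly_ring. (J +>\<^bsub>mpoly_ring\<^esub> r) \<otimes>\<^bsub>mpoly_ring Quot J\<^esub> (J +>\<^bsub>mpoly_ring\<^esub> f) = \<zero>\<^bsub>mpoly_ring Quot J\<^esub>}
      = {r. r * f \<in> J}" for f
    by (simp add: mult zero)
  then show ?thesis unfolding Ass_def carr by auto
qed

section \<open>Supports and coefficients of products\<close>

lemma sum_monomials: "f = (\<Sum>u\<in>keys f. single u (lookup f u))"
  by (rule poly_mapping_eqI)
    (simp add: lookup_sum lookup_single when_def not_in_keys_iff_lookup_eq_zero)

lemma sum_in_closed:
  assumes "0 \<in> I" "\<And>f g. f \<in> I \<Longrightarrow> g \<in> I \<Longrightarrow> f + g \<in> I" "\<And>x. x \<in> A \<Longrightarrow> h x \<in> I"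
  shows "sum h A \<in> (I :: 'a::comm_monoid_add set)"
  using assms(3) by (induction A rule: infinite_finite_induct) (auto intro: assms(1,2))

lemma lookup_times:
  fixes f g :: "('v, 'k::field) mpoly"
  shows "lookup (f * g) w = (\<Sum>(u, v)\<in>keys f \<times> keys g. if u + v = w then lookup f u * lookup g v else 0)"
proof -
  have "f * g = (\<Sum>u\<in>keys f. single u (lookup f u)) * (\<Sum>v\<in>keys g. single v (lookup g v))"
    using sum_monomials[of f] sum_monomials[of g] by simp
  also have "\<dots> = (\<Sum>(u, v)\<in>keys f \<times> keys g. single (u + v) (lookup f u * lookup g v))"
    by (simp add: sum_product sum.cartesian_product mult_single)
  finally have "lookup (f * g) w = lookup (\<Sum>(u, v)\<in>keys f \<times> keys g. single (u + v) (lookup f u * lookup g v)) w"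
    by simp
  also have "\<dots> = (\<Sum>(u, v)\<in>keys f \<times> keys g. if u + v = w then lookup f u * lookup g v else 0)"
    by (simp add: lookup_sum lookup_single when_def case_prod_unfold)
  finally show ?thesis .
qed

text \<open>An exponent produced by a single pair of terms suffers no cancellation. Together with
  \<open>unique_product\<close> this does the work of a leading-term argument.\<close>

lemma lookup_times_unique:
  fixes f g :: "('v, 'k::field) mpoly"
  assumes "u \<in> keys f" "v \<in> keys g"
    and "\<And>u' v'. u' \<in> keys f \<Longrightarrow> v' \<in> keys g \<Longrightarrow> u' + v' = u + v \<Longrightarrow> u' = u \<and> v' = v"
  shows "lookup (f * g) (u + v) = lookup f u * lookup g v"
proof -
  have "lookup (f * g) (u + v)
      = (\<Sum>p\<in>keys f \<times> keys g. if p = (u, v) then lookup f u * lookup g v else 0)"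
    unfolding lookup_times
  proof (rule sum.cong[OF refl])
    fix p assume "p \<in> keys f \<times> keys g"
    then show "(case p of (u', v') \<Rightarrow> if u' + v' = u + v then lookup f u' * lookup g v' else 0)
        = (if p = (u, v) then lookup f u * lookup g v else 0)"
      using assms(3)[of "fst p" "snd p"] by (cases p) auto
  qed
  then show ?thesis using assms(1,2) by simp
qed

lemma lookup_xpow_times:
  fixes f :: "('v, 'k::field) mpoly"
  shows "lookup (xpow u * f) (u + v) = lookup f v"
proof (cases "v \<in> keys f")
  case True
  then show ?thesis by (subst lookup_times_unique) auto
next
  case False
  then show ?thesis unfolding lookup_times
    by (auto simp: not_in_keys_iff_lookup_eq_zero intro!: sum.neutral)
qed

lemma keys_xpow_times:
  fixes f :: "('v, 'k::field) mpoly"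
  shows "keys (xpow u * f) = (+) u ` keys f"
proof
  show "keys (xpow u * f) \<subseteq> (+) u ` keys f" using keys_mult[of "xpow u" f] by auto
  show "(+) u ` keys f \<subseteq> keys (xpow u * f)" by (auto simp: in_keys_iff lookup_xpow_times)
qed

text \<open>
  The exponent vectors admit a compatible linear order, although the variables carry none:
  enumerate the variables and compare the images in \<open>nat \<Rightarrow>\<^sub>0 nat\<close>.
\<close>

lemma unique_product:
  fixes A B :: "('v::finite \<Rightarrow>\<^sub>0 nat) set"
  assumes "finite A" "A \<noteq> {}" "finite B" "B \<noteq> {}"
  obtains a b where "a \<in> A" "b \<in> B"
    "\<And>a' b'. a' \<in> A \<Longrightarrow> b' \<in> B \<Longrightarrow> a' + b' = a + b \<Longrightarrow> a' = a \<and> b' = b"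
proof -
  obtain i :: "'v \<Rightarrow> nat" where i: "inj i"
    using finite_imp_inj_to_nat_seg[OF finite_UNIV] by metis
  define \<phi> :: "('v \<Rightarrow>\<^sub>0 nat) \<Rightarrow> (nat \<Rightarrow>\<^sub>0 nat)"
    where "\<phi> u = (\<Sum>v\<in>UNIV. single (i v) (lookup u v))" for u
  have add: "\<phi> (u + w) = \<phi> u + \<phi> w" for u w
    by (simp add: \<phi>_def lookup_add single_add sum.distrib)
  have "lookup (\<phi> u) (i v) = lookup u v" for u v
    by (simp add: \<phi>_def lookup_sum lookup_single when_def inj_eq[OF i])
  then have inj: "u = w" if "\<phi> u = \<phi> w" for u w
    using that by (metis poly_mapping_eqI)
  \<comment> \<open>Leading exponents of \<open>A\<close> and \<open>B\<close>: any other
    representation of \<open>a + b\<close> would have a strictly smaller first summand and could not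
    reach the same image.\<close>
  obtain a where a: "a \<in> A" "\<And>a'. a' \<in> A \<Longrightarrow> \<phi> a' \<le> \<phi> a"
    using obtains_MAX[of A \<phi>] Max_ge[of "\<phi> ` A"] assms by (metis finite_imageI image_eqI)
  obtain b where b: "b \<in> B" "\<And>b'. b' \<in> B \<Longrightarrow> \<phi> b' \<le> \<phi> b"
    using obtains_MAX[of B \<phi>] Max_ge[of "\<phi> ` B"] assms by (metis finite_imageI image_eqI)
  show thesis
  proof (rule that[OF a(1) b(1)])
    fix a' b' assume ab: "a' \<in> A" "b' \<in> B" "a' + b' = a + b"
    then have e: "\<phi> a' + \<phi> b' = \<phi> a + \<phi> b" by (metis add)
    have "\<phi> a' = \<phi> a"
    proof (rule ccontr)
      assume "\<phi> a' \<noteq> \<phi> a"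
      then have "\<phi> a' < \<phi> a" using a(2) ab(1) by (simp add: order.not_eq_order_implies_strict)
      then have "\<phi> a' + \<phi> b' < \<phi> a + \<phi> b" using b(2)[OF ab(2)] by (rule add_less_le_mono)
      then show False using e by simp
    qed
    then show "a' = a \<and> b' = b" using ab(3) inj by force
  qed
qed

section \<open>Monomial ideals and primes generated by variables\<close>

definition upclosed :: "('v \<Rightarrow>\<^sub>0 nat) set \<Rightarrow> bool" where
  "upclosed U \<longleftrightarrow> (\<forall>u\<in>U. \<forall>w. w + u \<in> U)"

text \<open>The span of the monomials with exponent in \<open>U\<close>; it is an ideal once
  \<open>U\<close> is \<open>upclosed\<close>.\<close>

definition monomial_ideal :: "('v \<Rightarrow>\<^sub>0 nat) set \<Rightarrow> ('v, 'k::field) mpoly set" where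
  "monomial_ideal U = {f. keys f \<subseteq> U}"

text \<open>The ideal generated by the variables in \<open>C\<close>, described by the exponents
  divisible by one of them.\<close>

definition var_ideal :: "'v set \<Rightarrow> ('v, 'k::field) mpoly set" where
  "var_ideal C = monomial_ideal {u. \<exists>v\<in>C. lookup u v \<noteq> 0}"

lemma single_in_monomial_ideal: "c \<noteq> 0 \<Longrightarrow> single u c \<in> monomial_ideal U \<longleftrightarrow> u \<in> U"
  by (simp add: monomial_ideal_def)

lemma monomial_ideal_add:
  "f \<in> monomial_ideal U \<Longrightarrow> g \<in> monomial_ideal U \<Longrightarrow> f + g \<in> monomial_ideal U"
  using keys_add[of f g] by (auto simp: monomial_ideal_def)

lemma ideal_monomial_ideal:
  assumes "upclosed U"
  shows "ideal (monomial_ideal U :: ('v, 'k::field) mpoly set) mpoly_ring"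
proof (rule ideal_mpolyI)
  fix f g :: "('v, 'k) mpoly" assume "f \<in> monomial_ideal U"
  then show "g * f \<in> monomial_ideal U"
    using keys_mult[of g f] assms by (fastforce simp: monomial_ideal_def upclosed_def)
qed (simp_all add: monomial_ideal_add, simp add: monomial_ideal_def)

lemma monomial_ideal_subset:
  assumes "ideal I (mpoly_ring :: ('v, 'k::field) mpoly ring)" "\<And>u. u \<in> U \<Longrightarrow> xpow u \<in> I"
  shows "monomial_ideal U \<subseteq> I"
proof
  fix f :: "('v, 'k) mpoly" assume f: "f \<in> monomial_ideal U"
  have "(\<Sum>u\<in>keys f. single u (lookup f u)) \<in> I"
  proof (rule sum_in_closed)
    fix u assume "u \<in> keys f"
    then have "single 0 (lookup f u) * xpow u \<in> I"
      using f by (intro ideal_mpolyD(3)[OF assms(1)] assms(2)) (auto simp: monomial_ideal_def)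
    then show "single u (lookup f u) \<in> I" by (simp add: mult_single)
  qed (use ideal_mpolyD[OF assms(1)] in auto)
  then show "f \<in> I" using sum_monomials[of f] by simp
qed

lemma upclosed_var: "upclosed {u. \<exists>v\<in>C. lookup u v \<noteq> 0}"
  by (auto simp: upclosed_def lookup_add)

text \<open>If f and g both have terms free of the variables in \<open>C\<close>, a uniquely
  represented product of two such terms survives in \<open>f * g\<close>: summands of an exponent
  that vanishes on \<open>C\<close> vanish on \<open>C\<close> themselves.\<close>

lemma primeideal_var_ideal:
  fixes C :: "'v::finite set"
  shows "primeideal (var_ideal C :: ('v, 'k::field) mpoly set) mpoly_ring"
proof (rule primeidealI)
  show "ideal (var_ideal C :: ('v, 'k) mpoly set) mpoly_ring"
    unfolding var_ideal_def by (rule ideal_monomial_ideal[OF upclosed_var])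
  have "1 \<notin> (var_ideal C :: ('v, 'k) mpoly set)"
    by (simp add: var_ideal_def monomial_ideal_def)
  then show "carrier mpoly_ring \<noteq> (var_ideal C :: ('v, 'k) mpoly set)" by auto
next
  fix f g :: "('v, 'k) mpoly" assume fg: "f \<otimes>\<^bsub>mpoly_ring\<^esub> g \<in> var_ideal C"
  define Z where "Z = {u :: 'v \<Rightarrow>\<^sub>0 nat. \<forall>v\<in>C. lookup u v = 0}"
  show "f \<in> var_ideal C \<or> g \<in> var_ideal C"
  proof (rule ccontr)
    assume "\<not> (f \<in> var_ideal C \<or> g \<in> var_ideal C)"
    then have "keys f \<inter> Z \<noteq> {}" "keys g \<inter> Z \<noteq> {}"
      by (auto simp: var_ideal_def monomial_ideal_def Z_def)
    then obtain a b where ab: "a \<in> keys f \<inter> Z" "b \<in> keys g \<inter> Z"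
      "\<And>a' b'. a' \<in> keys f \<inter> Z \<Longrightarrow> b' \<in> keys g \<inter> Z \<Longrightarrow> a' + b' = a + b \<Longrightarrow> a' = a \<and> b' = b"
      using unique_product[of "keys f \<inter> Z" "keys g \<inter> Z"] by auto
    have "u \<in> Z \<and> v \<in> Z" if "u + v = a + b" for u v
    proof -
      have "lookup u x + lookup v x = 0" if "x \<in> C" for x
        using ab(1,2) that arg_cong[OF \<open>u + v = a + b\<close>, of "\<lambda>w. lookup w x"] by (simp add: Z_def lookup_add)
      then show ?thesis by (simp add: Z_def)
    qed
    then have "lookup (f * g) (a + b) = lookup f a * lookup g b"
      using ab by (intro lookup_times_unique) auto
    then have "a + b \<in> keys (f * g)" using ab(1,2) by (simp add: in_keys_iff)
    moreover have "a + b \<in> Z" using ab(1,2) by (simp add: Z_def lookup_add)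
    ultimately show False using fg by (auto simp: var_ideal_def monomial_ideal_def Z_def)
  qed
qed (rule cring_mpoly)

lemma var_ideal_UNIV: "var_ideal UNIV = (max_ideal :: ('v::finite, 'k::field) mpoly set)"
proof
  interpret cring "mpoly_ring :: ('v, 'k) mpoly ring" by (rule cring_mpoly)
  have id: "ideal (max_ideal :: ('v, 'k) mpoly set) mpoly_ring"
    unfolding max_ideal_def by (rule genideal_ideal) simp
  show "var_ideal UNIV \<subseteq> (max_ideal :: ('v, 'k) mpoly set)"
    unfolding var_ideal_def
  proof (rule monomial_ideal_subset[OF id])
    fix u :: "'v \<Rightarrow>\<^sub>0 nat" assume "u \<in> {u. \<exists>v\<in>UNIV. lookup u v \<noteq> 0}"
    then obtain v where v: "lookup u v \<noteq> 0" by auto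
    have "Var v \<in> (max_ideal :: ('v, 'k) mpoly set)"
      unfolding max_ideal_def using genideal_self by fastforce
    then have "xpow (u - single v 1) * Var v \<in> (max_ideal :: ('v, 'k) mpoly set)"
      by (rule ideal_mpolyD(3)[OF id])
    moreover have "u - single v 1 + single v 1 = u"
      by (rule poly_mapping_eqI) (use v in \<open>auto simp: lookup_add lookup_minus lookup_single when_def\<close>)
    ultimately show "xpow u \<in> (max_ideal :: ('v, 'k) mpoly set)"
      by (simp add: Var_def mult_single)
  qed
  show "(max_ideal :: ('v, 'k) mpoly set) \<subseteq> var_ideal UNIV"
    unfolding max_ideal_def var_ideal_def
    by (rule genideal_minimal[OF ideal_monomial_ideal[OF upclosed_var]])
      (force simp: Var_def single_in_monomial_ideal lookup_single when_def)
qed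

lemma times_xpow_in_monomial_ideal:
  "f * xpow w \<in> monomial_ideal U \<longleftrightarrow> (\<forall>u\<in>keys f. w + u \<in> U)"
  by (subst mult.commute) (auto simp: monomial_ideal_def keys_xpow_times)

text \<open>
  A witness \<open>f\<close> of \<open>P\<close> with the fewest terms outside the monomial ideal forces \<open>P\<close> to be monomial:
  otherwise multiplying \<open>f\<close> by a suitable monomial outside \<open>P\<close> kills one more term.
\<close>

lemma Ass_monomial_witness:
  fixes P :: "('v::finite, 'k::field) mpoly set"
  assumes U: "upclosed U" and P: "primeideal P mpoly_ring" and f: "P = {r. r * f \<in> monomial_ideal U}"
  shows "\<exists>w. P = {r. r * xpow w \<in> monomial_ideal U} \<and> (\<forall>g\<in>P. \<forall>u\<in>keys g. xpow u \<in> P)"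
proof -
  interpret P: primeideal P mpoly_ring by (rule P)
  note PI = ideal_mpolyD[OF P.is_ideal]
  note JI = ideal_mpolyD[OF ideal_monomial_ideal[OF U]]
  have prime: "a \<in> P \<or> b \<in> P" if "a * b \<in> P" for a b using P.I_prime that by simp
  have one: "1 \<notin> P" using P.one_imp_carrier P.I_notcarr by auto
  define m where "m f = card (keys f - U)" for f :: "('v, 'k) mpoly"
  define f0 where "f0 = (ARG_MIN m f. P = {r. r * f \<in> monomial_ideal U})"
  have f0: "P = {r. r * f0 \<in> monomial_ideal U}"
    and min: "\<And>f'. P = {r. r * f' \<in> monomial_ideal U} \<Longrightarrow> m f0 \<le> m f'"
    unfolding f0_def using arg_min_nat_lemma[of "\<lambda>f. P = {r. r * f \<in> monomial_ideal U}" f m] f by blast+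
  have f0J: "f0 \<notin> monomial_ideal U" using one f0 by auto
  have mon: "\<forall>u\<in>keys g. xpow u \<in> P" if "g \<in> P" for g
    using that
  proof (induction "card (keys g)" arbitrary: g rule: less_induct)
    case less
    show ?case
    proof (cases "g = 0")
      case False
      then have "keys g \<noteq> {}" "keys f0 - U \<noteq> {}"
        using f0J by (auto simp: monomial_ideal_def)
      then obtain a b where ab: "a \<in> keys g" "b \<in> keys f0 - U"
        "\<And>a' b'. a' \<in> keys g \<Longrightarrow> b' \<in> keys f0 - U \<Longrightarrow> a' + b' = a + b \<Longrightarrow> a' = a \<and> b' = b"
        using unique_product[of "keys g" "keys f0 - U"] by (metis finite_Diff finite_keys)
      \<comment> \<open>Outside \<open>U\<close> the exponent \<open>a + b\<close> would have no
        second representation, since a summand in \<open>U\<close> puts the sum into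
        \<open>U\<close>. Its coefficient would then survive in \<open>g * f0\<close>, which lies in
        the monomial ideal.\<close>
      have abU: "a + b \<in> U"
      proof (rule ccontr)
        assume nU: "a + b \<notin> U"
        have "a' = a \<and> b' = b" if "a' \<in> keys g" "b' \<in> keys f0" "a' + b' = a + b" for a' b'
        proof -
          have "b' \<notin> U" using U nU that(3) unfolding upclosed_def by metis
          then show ?thesis using ab(3) that by blast
        qed
        then have "lookup (g * f0) (a + b) = lookup g a * lookup f0 b"
          using ab(1,2) by (intro lookup_times_unique) auto
        then have "a + b \<in> keys (g * f0)" using ab(1,2) by (simp add: in_keys_iff)
        moreover have "g * f0 \<in> monomial_ideal U" using less.prems f0 by auto
        ultimately show False using nU by (auto simp: monomial_ideal_def)
      qed
      have aP: "xpow a \<in> P"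
      proof (rule ccontr)
        assume aP: "xpow a \<notin> P"
        have "P = {r. r * (xpow a * f0) \<in> monomial_ideal U}"
        proof -
          have "r \<in> P \<longleftrightarrow> r * xpow a \<in> P" for r
            using prime[of r "xpow a"] aP PI(3)[of r "xpow a"] by (auto simp: mult.commute)
          then show ?thesis using f0 by (auto simp: mult.assoc)
        qed
        then have "m f0 \<le> m (xpow a * f0)" by (rule min)
        moreover have "keys (xpow a * f0) - U \<subseteq> (+) a ` (keys f0 - U - {b})"
          using abU U by (auto simp: keys_xpow_times upclosed_def)
        then have "m (xpow a * f0) \<le> card ((+) a ` (keys f0 - U - {b}))"
          unfolding m_def by (rule card_mono[rotated]) simp
        then have "m (xpow a * f0) \<le> card (keys f0 - U - {b})"
          using card_image_le[of "keys f0 - U - {b}" "(+) a"] by simp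
        moreover have "card (keys f0 - U - {b}) < m f0"
          unfolding m_def using ab(2) by (intro psubset_card_mono) auto
        ultimately show False by simp
      qed
      define h where "h = g - single a (lookup g a)"
      have "single 0 (lookup g a) * xpow a \<in> P" by (rule PI(3)[OF aP])
      then have hP: "h \<in> P" unfolding h_def using less.prems by (intro PI(4)) (auto simp: mult_single)
      have kh: "keys h = keys g - {a}"
        by (auto simp: h_def in_keys_iff lookup_minus lookup_single when_def split: if_splits)
      then have "card (keys h) < card (keys g)"
        using ab(1) by (metis card_Diff1_less finite_keys)
      from less.hyps[OF this hP] aP kh show ?thesis by auto
    qed simp
  qed
  \<comment> \<open>Otherwise each term of \<open>f0\<close> has a multiplier outside
    \<open>P\<close> that sends it into the monomial ideal. The product of these multipliers sends
    all of \<open>f0\<close> there, yet it avoids the prime \<open>P\<close>.\<close>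
  have "\<exists>w\<in>keys f0. {r. r * xpow w \<in> monomial_ideal U} \<subseteq> P"
  proof (rule ccontr)
    assume "\<not> ?thesis"
    then have "\<forall>w\<in>keys f0. \<exists>r. r \<notin> P \<and> r * xpow w \<in> monomial_ideal U" by auto
    then obtain r where r: "\<And>w. w \<in> keys f0 \<Longrightarrow> r w \<notin> P \<and> r w * xpow w \<in> monomial_ideal U"
      by metis
    define q where "q = prod r (keys f0)"
    have "prod r A \<notin> P" if "finite A" "A \<subseteq> keys f0" for A
      using that by (induction A rule: finite_induct) (use one r prime in auto)
    then have "q \<notin> P" by (simp add: q_def)
    moreover have "q * f0 \<in> monomial_ideal U"
    proof -
      have "q * single w (lookup f0 w) \<in> monomial_ideal U" if w: "w \<in> keys f0" for w
      proof -
        have "q = prod r (keys f0 - {w}) * r w"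
          unfolding q_def using prod.remove[OF finite_keys w, of r] by (simp add: mult.commute)
        then have "q * single w (lookup f0 w)
            = (prod r (keys f0 - {w}) * single 0 (lookup f0 w)) * (r w * xpow w)"
          by (simp add: mult.assoc mult.left_commute[of "single 0 _"] mult_single)
        then show ?thesis using JI(3) r[OF w] by metis
      qed
      then have "(\<Sum>w\<in>keys f0. q * single w (lookup f0 w)) \<in> monomial_ideal U"
        using JI by (intro sum_in_closed) auto
      then show ?thesis using sum_monomials[of f0] by (simp add: sum_distrib_left[symmetric])
    qed
    ultimately show False using f0 by auto
  qed
  then obtain w where w: "w \<in> keys f0" "{r. r * xpow w \<in> monomial_ideal U} \<subseteq> P" by auto
  have "g * xpow w \<in> monomial_ideal U" if "g \<in> P" for g
    unfolding times_xpow_in_monomial_ideal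
  proof
    fix u assume "u \<in> keys g"
    then have "xpow u * f0 \<in> monomial_ideal U" using mon[OF that] f0 by auto
    then show "w + u \<in> U" using w(1) by (auto simp: monomial_ideal_def keys_xpow_times add.commute)
  qed
  then show ?thesis using w(2) mon by (intro exI[of _ w]) auto
qed

lemma xpow_in_prime:
  fixes P :: "('v::finite, 'k::field) mpoly set"
  assumes "primeideal P mpoly_ring"
  shows "xpow u \<in> P \<longleftrightarrow> (\<exists>v. Var v \<in> P \<and> lookup u v \<noteq> 0)"
proof -
  interpret P: primeideal P mpoly_ring by (rule assms)
  have prime: "a \<in> P \<or> b \<in> P" if "a * b \<in> P" for a b using P.I_prime that by simp
  have one: "1 \<notin> P" using P.one_imp_carrier P.I_notcarr by auto
  show ?thesis
  proof
    assume "xpow u \<in> P"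
    then show "\<exists>v. Var v \<in> P \<and> lookup u v \<noteq> 0"
    proof (induction "\<Sum>v\<in>UNIV. lookup u v" arbitrary: u rule: less_induct)
      case less
      have "u \<noteq> 0" using less.prems one by auto
      then obtain v where v: "lookup u v \<noteq> 0" by (metis lookup_zero poly_mapping_eqI)
      have e: "u = single v 1 + (u - single v 1)"
        by (rule poly_mapping_eqI) (use v in \<open>auto simp: lookup_add lookup_minus lookup_single when_def\<close>)
      then have "Var v * xpow (u - single v 1) \<in> P"
        using less.prems by (simp add: Var_def mult_single)
      then consider "Var v \<in> P" | "xpow (u - single v 1) \<in> P" using prime by blast
      then show ?case
      proof cases
        case 2
        have "(\<Sum>x\<in>UNIV. lookup (u - single v 1) x) < (\<Sum>x\<in>UNIV. lookup u x)"
          by (rule sum_strict_mono2[of _ _ v] sum_strict_mono_ex1)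
            (use v in \<open>auto simp: lookup_minus lookup_single when_def intro!: exI[of _ v]\<close>)
        from less.hyps[OF this 2] show ?thesis by (auto simp: lookup_minus)
      qed (use v in auto)
    qed
  next
    assume "\<exists>v. Var v \<in> P \<and> lookup u v \<noteq> 0"
    then obtain v where v: "Var v \<in> P" "lookup u v \<noteq> 0" by auto
    have e: "u - single v 1 + single v 1 = u"
      by (rule poly_mapping_eqI) (use v in \<open>auto simp: lookup_add lookup_minus lookup_single when_def\<close>)
    have "xpow (u - single v 1) * Var v \<in> P" by (rule ideal_mpolyD(3)[OF P.is_ideal v(1)])
    then show "xpow u \<in> P" using e by (simp add: Var_def mult_single)
  qed
qed

text \<open>The two conditions on \<open>w\<close> say together that \<open>w + u\<close> lies in
  \<open>U\<close> exactly when \<open>u\<close> is nonzero somewhere on \<open>C\<close>, so that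
  the colon ideal of the monomial \<open>xpow w\<close> is \<open>var_ideal C\<close>. Conversely
  \<open>C\<close> consists of the variables in the given prime.\<close>

theorem Ass_monomial_ideal:
  fixes U :: "('v::finite \<Rightarrow>\<^sub>0 nat) set"
  assumes U: "upclosed U"
  shows "(P :: ('v, 'k::field) mpoly set) \<in> Ass mpoly_ring (monomial_ideal U) \<longleftrightarrow>
    (\<exists>C w. P = var_ideal C \<and> (\<forall>v\<in>C. w + single v 1 \<in> U) \<and>
      (\<forall>u. (\<forall>v\<in>C. lookup u v = 0) \<longrightarrow> w + u \<notin> U))" (is "?L \<longleftrightarrow> ?R")
proof
  assume ?L
  then obtain f where P: "primeideal P mpoly_ring" and f: "P = {r. r * f \<in> monomial_ideal U}"
    by (auto simp: Ass_mpoly[OF ideal_monomial_ideal[OF U]])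
  from Ass_monomial_witness[OF U P f] obtain w where
    w: "P = {r. r * xpow w \<in> monomial_ideal U}" and mon: "\<forall>g\<in>P. \<forall>u\<in>keys g. xpow u \<in> P" by auto
  define C where "C = {v. Var v \<in> P}"
  have key: "xpow u \<in> P \<longleftrightarrow> w + u \<in> U" for u :: "'v \<Rightarrow>\<^sub>0 nat"
    by (subst w) (simp add: times_xpow_in_monomial_ideal)
  have "P = var_ideal C"
  proof
    show "P \<subseteq> var_ideal C"
      using mon by (auto simp: var_ideal_def monomial_ideal_def C_def xpow_in_prime[OF P])
    show "var_ideal C \<subseteq> P" unfolding var_ideal_def
      using primeideal.axioms(1)[OF P] by (rule monomial_ideal_subset) (auto simp: C_def xpow_in_prime[OF P])
  qed
  moreover have "\<forall>v\<in>C. w + single v 1 \<in> U"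
    using key by (auto simp: C_def Var_def)
  moreover have "\<forall>u. (\<forall>v\<in>C. lookup u v = 0) \<longrightarrow> w + u \<notin> U"
    by (auto simp: C_def key[symmetric] xpow_in_prime[OF P])
  ultimately show ?R by blast
next
  assume ?R
  then obtain C w where P: "P = var_ideal C" and a: "\<forall>v\<in>C. w + single v 1 \<in> U"
    and b: "\<forall>u. (\<forall>v\<in>C. lookup u v = 0) \<longrightarrow> w + u \<notin> U" by auto
  have "w + u \<in> U \<longleftrightarrow> (\<exists>v\<in>C. lookup u v \<noteq> 0)" for u
  proof
    assume "\<exists>v\<in>C. lookup u v \<noteq> 0"
    then obtain v where v: "v \<in> C" "lookup u v \<noteq> 0" by auto
    have "w + u = (u - single v 1) + (w + single v 1)"
      by (rule poly_mapping_eqI) (use v in \<open>auto simp: lookup_add lookup_minus lookup_single when_def\<close>)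
    then show "w + u \<in> U" using a v(1) U unfolding upclosed_def by metis
  qed (use b in auto)
  then have "r \<in> var_ideal C \<longleftrightarrow> r * xpow w \<in> monomial_ideal U" for r :: "('v, 'k) mpoly"
    unfolding times_xpow_in_monomial_ideal by (auto simp: var_ideal_def monomial_ideal_def)
  then have "var_ideal C = {r :: ('v, 'k) mpoly. r * xpow w \<in> monomial_ideal U}" by auto
  then show ?L unfolding Ass_mpoly[OF ideal_monomial_ideal[OF U]] using primeideal_var_ideal[of C, where 'k = 'k] P by auto
qed

section \<open>Powers of edge ideals\<close>

text \<open>The degree of \<open>v\<close> in the multigraph \<open>M\<close>, hence the exponent of
  \<open>v\<close> in the product of the edge monomials of \<open>M\<close>.\<close>

definition edeg :: "'v set multiset \<Rightarrow> 'v \<Rightarrow> nat" where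
  "edeg M v = (\<Sum>e\<in>#M. of_bool (v \<in> e))"

text \<open>Divisibility: some product of \<open>n\<close> edge monomials divides the monomial with
  exponent vector \<open>a\<close>.\<close>

definition fits :: "'v set set \<Rightarrow> nat \<Rightarrow> ('v \<Rightarrow> nat) \<Rightarrow> bool" where
  "fits E n a \<longleftrightarrow> (\<exists>M. set_mset M \<subseteq> E \<and> size M = n \<and> (\<forall>v. edeg M v \<le> a v))"

lemma edeg_simps [simp]:
  "edeg {#} v = 0"
  "edeg (add_mset e M) v = of_bool (v \<in> e) + edeg M v"
  "edeg (M + N) v = edeg M v + edeg N v"
  by (simp_all add: edeg_def)

lemma edeg_mono: "M \<subseteq># N \<Longrightarrow> edeg M v \<le> edeg N v"
  by (metis edeg_simps(3) le_add1 mset_subset_eq_exists_conv)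

lemma edeg_diff: "M \<subseteq># N \<Longrightarrow> edeg (N - M) v = edeg N v - edeg M v"
  by (metis add_diff_cancel_left' edeg_simps(3) subset_mset.add_diff_inverse)

lemma edeg_pos: "edeg M v > 0 \<longleftrightarrow> (\<exists>e\<in>#M. v \<in> e)"
  by (induction M) auto

lemma edeg_le_size: "edeg M v \<le> size M"
  by (induction M) (auto simp: of_bool_def)

lemma edeg_eq_size: "(\<And>e. e \<in># M \<Longrightarrow> v \<in> e) \<Longrightarrow> edeg M v = size M"
  by (induction M) auto

lemma sum_edeg:
  fixes M :: "'v::finite set multiset"
  assumes "\<And>e. e \<in># M \<Longrightarrow> card e = 2"
  shows "(\<Sum>v\<in>UNIV. edeg M v) = 2 * size M"
  using assms by (induction M) (auto simp: sum.distrib of_bool_def simp flip: card_eq_sum sum.inter_filter)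

lemma fitsI: "set_mset M \<subseteq> E \<Longrightarrow> size M = n \<Longrightarrow> (\<And>v. edeg M v \<le> a v) \<Longrightarrow> fits E n a"
  by (auto simp: fits_def)

lemma fits_mono: "fits E n a \<Longrightarrow> (\<And>v. a v \<le> b v) \<Longrightarrow> fits E n b"
  unfolding fits_def by (elim exE conjE, rule exI, intro conjI) (auto intro: le_trans)

lemma fits_add:
  assumes "fits E m a" "fits E n b"
  shows "fits E (m + n) (\<lambda>v. a v + b v)"
proof -
  obtain M N where "set_mset M \<subseteq> E" "size M = m" "\<forall>v. edeg M v \<le> a v"
    "set_mset N \<subseteq> E" "size N = n" "\<forall>v. edeg N v \<le> b v"
    using assms by (auto simp: fits_def)
  then show ?thesis by (intro fitsI[of "M + N"]) (auto intro: add_mono)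
qed

lemma fits_Suc:
  assumes "fits E (Suc n) a"
  obtains e where "e \<in> E" "\<And>v. of_bool (v \<in> e) \<le> a v" "fits E n (\<lambda>v. a v - of_bool (v \<in> e))"
proof -
  obtain M where M: "set_mset M \<subseteq> E" "size M = Suc n" "\<forall>v. edeg M v \<le> a v"
    using assms by (auto simp: fits_def)
  then obtain e N where N: "M = add_mset e N" by (metis size_eq_Suc_imp_eq_union)
  have le: "of_bool (v \<in> e) + edeg N v \<le> a v" for v using M(3) N by (metis edeg_simps(2))
  show thesis
  proof (rule that)
    show "fits E n (\<lambda>v. a v - of_bool (v \<in> e))"
    proof (rule fitsI[of N])
      show "edeg N v \<le> a v - of_bool (v \<in> e)" for v using le[of v] by linarith
    qed (use M(1,2) N in auto)
    show "of_bool (v \<in> e) \<le> a v" for v using le[of v] by linarith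
  qed (use M(1) N in auto)
qed

section \<open>Powers of the edge ideal as monomial ideals\<close>

abbreviation fit_exps :: "'v set set \<Rightarrow> nat \<Rightarrow> ('v \<Rightarrow>\<^sub>0 nat) set" where
  "fit_exps E n \<equiv> {u. fits E n (lookup u)}"

lemma upclosed_fit_exps: "upclosed (fit_exps E n)"
  by (auto simp: upclosed_def lookup_add intro: fits_mono)

text \<open>Over a finite set of variables every function has finite support, so plain functions can
  serve as exponent vectors.\<close>

definition exp_of :: "('v::finite \<Rightarrow> nat) \<Rightarrow> ('v \<Rightarrow>\<^sub>0 nat)" where
  "exp_of a = Abs_poly_mapping a"

lemma lookup_exp_of [simp]: "lookup (exp_of a) = a"
  unfolding exp_of_def by (rule lookup_Abs_poly_mapping) simp

lemma fits_edge:
  assumes "simple_graph E" "{p, q} \<in> E"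
  shows "fits E 1 (lookup (single p 1 + single q 1))" "p \<noteq> q"
proof -
  show "p \<noteq> q" using assms by (auto simp: simple_graph_def)
  then show "fits E 1 (lookup (single p 1 + single q 1))"
    using assms(2) by (intro fitsI[of "{#{p, q}#}"]) (auto simp: lookup_add lookup_single when_def)
qed

lemma edge_ideal_eq:
  assumes "simple_graph E"
  shows "edge_ideal E = (monomial_ideal (fit_exps E 1) :: ('v::finite, 'k::field) mpoly set)"
proof
  interpret cring "mpoly_ring :: ('v, 'k) mpoly ring" by (rule cring_mpoly)
  have id: "ideal (edge_ideal E :: ('v, 'k) mpoly set) mpoly_ring"
    unfolding edge_ideal_def by (rule genideal_ideal) simp
  show "edge_ideal E \<subseteq> (monomial_ideal (fit_exps E 1) :: ('v, 'k) mpoly set)"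
    unfolding edge_ideal_def
  proof (rule genideal_minimal[OF ideal_monomial_ideal[OF upclosed_fit_exps]], clarify)
    fix p q assume "{p, q} \<in> E"
    from fits_edge[OF assms this] show "Var p * Var q \<in> (monomial_ideal (fit_exps E 1) :: ('v, 'k) mpoly set)"
      by (simp add: Var_def mult_single single_in_monomial_ideal)
  qed
  show "(monomial_ideal (fit_exps E 1) :: ('v, 'k) mpoly set) \<subseteq> edge_ideal E"
  proof (rule monomial_ideal_subset[OF id])
    fix u assume "u \<in> fit_exps E 1"
    then have "fits E (Suc 0) (lookup u)" by simp
    then obtain e where e: "e \<in> E" "\<And>v. of_bool (v \<in> e) \<le> lookup u v" by (rule fits_Suc) blast
    then obtain p q where pq: "e = {p, q}" "p \<noteq> q"
      using assms by (metis card_2_iff simple_graph_def)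
    have "Var p * Var q \<in> (edge_ideal E :: ('v, 'k) mpoly set)"
      unfolding edge_ideal_def using e(1) pq(1) by (intro subsetD[OF genideal_self]) auto
    then have "xpow (u - (single p 1 + single q 1)) * (Var p * Var q) \<in> (edge_ideal E :: ('v, 'k) mpoly set)"
      by (rule ideal_mpolyD(3)[OF id])
    moreover have "u - (single p 1 + single q 1) + (single p 1 + single q 1) = u"
      using e(2)[of p] e(2)[of q] pq
      by (intro poly_mapping_eqI) (auto simp: lookup_add lookup_minus lookup_single when_def)
    ultimately show "xpow u \<in> (edge_ideal E :: ('v, 'k) mpoly set)"
      by (simp add: Var_def mult_single)
  qed
qed

text \<open>Induction on \<open>n\<close>: a packing of n + 1 edges splits into one edge and a
  packing of n edges, and exponents add under products.\<close>

lemma ideal_pow_edge_ideal: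
  assumes "simple_graph E"
  shows "ideal_pow mpoly_ring (edge_ideal E) n
    = (monomial_ideal (fit_exps E n) :: ('v::finite, 'k::field) mpoly set)"
proof (induction n)
  case 0
  have "fit_exps E 0 = UNIV" by (auto simp: fits_def)
  then show ?case by (simp add: ideal_pow_def ideals_set_def monomial_ideal_def)
next
  case (Suc n)
  interpret cring "mpoly_ring :: ('v, 'k) mpoly ring" by (rule cring_mpoly)
  let ?J = "\<lambda>n. monomial_ideal (fit_exps E n) :: ('v, 'k) mpoly set"
  have id: "ideal (?J n) mpoly_ring" for n
    by (rule ideal_monomial_ideal[OF upclosed_fit_exps])
  have "?J n \<cdot>\<^bsub>mpoly_ring\<^esub> ?J 1 = ?J (Suc n)"
  proof
    show "?J n \<cdot>\<^bsub>mpoly_ring\<^esub> ?J 1 \<subseteq> ?J (Suc n)"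
    proof
      fix f assume "f \<in> ?J n \<cdot>\<^bsub>mpoly_ring\<^esub> ?J 1"
      then show "f \<in> ?J (Suc n)"
      proof induction
        case (prod f g)
        have "fits E (Suc n) (lookup w)" if w: "w \<in> keys (f * g)" for w
        proof -
          obtain u v where "w = u + v" "u \<in> keys f" "v \<in> keys g"
            using keys_mult[of f g] w by auto
          then show ?thesis
            using fits_add[of E n "lookup u" 1 "lookup v"] prod by (auto simp: monomial_ideal_def lookup_add[abs_def])
        qed
        then show ?case by (auto simp: monomial_ideal_def)
      qed (simp add: monomial_ideal_add)
    qed
    have id': "ideal (?J n \<cdot>\<^bsub>mpoly_ring\<^esub> ?J 1) mpoly_ring" by (rule ideal_prod_is_ideal[OF id id])
    show "?J (Suc n) \<subseteq> ?J n \<cdot>\<^bsub>mpoly_ring\<^esub> ?J 1"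
    proof (rule monomial_ideal_subset[OF id'])
      fix u assume "u \<in> fit_exps E (Suc n)"
      then have "fits E (Suc n) (lookup u)" by simp
      then obtain e where e: "e \<in> E" "\<And>v. of_bool (v \<in> e) \<le> lookup u v"
        "fits E n (\<lambda>v. lookup u v - of_bool (v \<in> e))" by (rule fits_Suc) blast
      define w where "w = exp_of (\<lambda>v. of_bool (v \<in> e))"
      have "lookup (u - w) = (\<lambda>v. lookup u v - of_bool (v \<in> e))"
        by (rule ext) (simp add: w_def lookup_minus)
      then have "u - w \<in> fit_exps E n" using e(3) by simp
      moreover have "w \<in> fit_exps E 1" unfolding w_def
        using e(1) by (auto intro!: fitsI[of "{#e#}"])
      ultimately have "xpow (u - w) \<otimes>\<^bsub>mpoly_ring\<^esub> xpow w \<in> ?J n \<cdot>\<^bsub>mpoly_ring\<^esub> ?J 1"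
        by (intro ideal_prod.prod) (simp_all add: single_in_monomial_ideal)
      moreover have "u - w + w = u"
        using e(2) by (intro poly_mapping_eqI) (simp add: w_def lookup_minus lookup_add)
      ultimately show "xpow u \<in> ?J n \<cdot>\<^bsub>mpoly_ring\<^esub> ?J 1" by (simp add: mult_single)
    qed
  qed
  moreover have "ideal_pow mpoly_ring (edge_ideal E) (Suc n)
      = ideal_pow mpoly_ring (edge_ideal E) n \<cdot>\<^bsub>mpoly_ring\<^esub> (edge_ideal E :: ('v, 'k) mpoly set)"
    by (simp add: ideal_pow_def ideals_set_def nat_pow_Suc)
  ultimately show ?case using Suc.IH edge_ideal_eq[OF assms, where 'k = 'k] by simp
qed

text \<open>
  By \<open>Ass_power_iff\<close> below, \<open>ass_witness E n C a\<close> says that the monomial with exponent vector \<open>a\<close>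
  has annihilator \<open>(x\<^sub>v : v \<in> C)\<close> modulo the \<open>n\<close>-th power of the edge ideal.
\<close>

definition ass_witness :: "'v::finite set set \<Rightarrow> nat \<Rightarrow> 'v set \<Rightarrow> ('v \<Rightarrow> nat) \<Rightarrow> bool" where
  "ass_witness E n C a \<longleftrightarrow> (\<forall>v\<in>C. fits E n (\<lambda>x. a x + of_bool (x = v))) \<and>
     (\<forall>b. (\<forall>v\<in>C. b v = 0) \<longrightarrow> \<not> fits E n (\<lambda>x. a x + b x))"

lemma Ass_power_iff:
  fixes P :: "('v::finite, 'k::field) mpoly set"
  assumes "simple_graph E"
  shows "P \<in> Ass mpoly_ring (ideal_pow mpoly_ring (edge_ideal E) n) \<longleftrightarrow>
    (\<exists>C a. P = var_ideal C \<and> ass_witness E n C a)"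
proof -
  have a: "w + single v 1 \<in> fit_exps E n \<longleftrightarrow> fits E n (\<lambda>x. lookup w x + of_bool (x = v))" for w :: "'v \<Rightarrow>\<^sub>0 nat" and v
    by (simp add: lookup_add[abs_def] lookup_single when_def of_bool_def eq_commute[of v] cong: if_cong)
  have b: "(\<forall>u. (\<forall>v\<in>C. lookup u v = 0) \<longrightarrow> w + u \<notin> fit_exps E n) \<longleftrightarrow>
      (\<forall>b. (\<forall>v\<in>C. b v = 0) \<longrightarrow> \<not> fits E n (\<lambda>x. lookup w x + b x))" for w :: "'v \<Rightarrow>\<^sub>0 nat" and C
  proof (intro iffI allI impI)
    fix b :: "'v \<Rightarrow> nat" assume "\<forall>u. (\<forall>v\<in>C. lookup u v = 0) \<longrightarrow> w + u \<notin> fit_exps E n" "\<forall>v\<in>C. b v = 0"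
    then have "w + exp_of b \<notin> fit_exps E n" by simp
    then show "\<not> fits E n (\<lambda>x. lookup w x + b x)" by (simp add: lookup_add[abs_def])
  next
    fix u :: "'v \<Rightarrow>\<^sub>0 nat" assume "\<forall>b :: 'v \<Rightarrow> nat. (\<forall>v\<in>C. b v = 0) \<longrightarrow> \<not> fits E n (\<lambda>x. lookup w x + b x)" "\<forall>v\<in>C. lookup u v = 0"
    then show "w + u \<notin> fit_exps E n" by (simp add: lookup_add[abs_def])
  qed
  show ?thesis
    unfolding ideal_pow_edge_ideal[OF assms] Ass_monomial_ideal[OF upclosed_fit_exps] a b ass_witness_def
  proof (intro iffI; elim exE)
    fix C and w :: "'v \<Rightarrow>\<^sub>0 nat"
    assume "P = var_ideal C \<and> (\<forall>v\<in>C. fits E n (\<lambda>x. lookup w x + of_bool (x = v))) \<and>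
      (\<forall>b. (\<forall>v\<in>C. b v = 0) \<longrightarrow> \<not> fits E n (\<lambda>x. lookup w x + b x))"
    then show "\<exists>C a. P = var_ideal C \<and> (\<forall>v\<in>C. fits E n (\<lambda>x. a x + of_bool (x = v))) \<and>
      (\<forall>b. (\<forall>v\<in>C. b v = 0) \<longrightarrow> \<not> fits E n (\<lambda>x. a x + b x))" by blast
  next
    fix C a
    assume "P = var_ideal C \<and> (\<forall>v\<in>C. fits E n (\<lambda>x. a x + of_bool (x = v))) \<and>
      (\<forall>b. (\<forall>v\<in>C. b v = 0) \<longrightarrow> \<not> fits E n (\<lambda>x. a x + b x))"
    then show "\<exists>C (w :: 'v \<Rightarrow>\<^sub>0 nat). P = var_ideal C \<and>
      (\<forall>v\<in>C. fits E n (\<lambda>x. lookup w x + of_bool (x = v))) \<and>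
      (\<forall>b. (\<forall>v\<in>C. b v = 0) \<longrightarrow> \<not> fits E n (\<lambda>x. lookup w x + b x))"
      by (intro exI[of _ C] exI[of _ "exp_of a"]) simp
  qed
qed

section \<open>Bipartite components\<close>

lemma simple_graphD: "simple_graph E \<Longrightarrow> e \<in> E \<Longrightarrow> card e = 2"
  by (simp add: simple_graph_def)

lemma simple_edge:
  assumes "simple_graph E" "e \<in> E" "v \<in> e"
  obtains w where "e = {v, w}" "v \<noteq> w"
  using simple_graphD[OF assms(1,2)] assms(3) by (auto simp: card_2_iff doubleton_eq_iff)

lemma edeg_replicate [simp]: "edeg (replicate_mset n e) v = n * of_bool (v \<in> e)"
  by (induction n) auto

text \<open>
  Starting at \<open>x\<close>, follow an alternating trail through the edges of \<open>B\<close> and \<open>A\<close> until it cannot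
  be continued. Its length is even or odd according to the side of its last vertex \<open>y\<close>.
\<close>

lemma bipartite_exchange:
  fixes A B :: "'v set multiset"
  assumes "\<And>e. e \<in># A + B \<Longrightarrow> \<exists>p q. p \<in> L \<and> q \<notin> L \<and> e = {p, q}"
    and "x \<in> L" "edeg A x < edeg B x"
  shows "\<exists>A' B' y. A' \<subseteq># A \<and> B' \<subseteq># B \<and>
    ((y \<in> L \<and> size B' = size A' \<and> edeg B y < edeg A y \<and>
        (\<forall>v. edeg B' v + of_bool (v = y) = edeg A' v + of_bool (v = x))) \<or>
     (y \<notin> L \<and> size B' = Suc (size A') \<and> edeg A y < edeg B y \<and>
        (\<forall>v. edeg B' v = edeg A' v + of_bool (v = x) + of_bool (v = y))))"
    (is "\<exists>A' B' y. ?Q A B x A' B' y")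
  using assms
proof (induction "size B" arbitrary: A B x rule: less_induct)
  case less
  from less.prems(3) obtain f where f: "f \<in># B" "x \<in> f"
    using edeg_pos[of B x] by auto
  then obtain z where z: "f = {x, z}" "z \<notin> L"
    using less.prems(1)[of f] less.prems(2) by auto
  have fdeg: "edeg {#f#} v = of_bool (v = x) + of_bool (v = z)" for v
    using z less.prems(2) by auto
  show ?case
  proof (cases "edeg A z < edeg B z")
    case True
    then have "?Q A B x {#} {#f#} z" using f z fdeg by auto
    then show ?thesis by blast
  next
    case False
    have "edeg B z > 0" using f(1) z by (auto simp: edeg_pos)
    then have "edeg A z > 0" using False by simp
    then obtain g where g: "g \<in># A" "z \<in> g" by (auto simp: edeg_pos)
    then obtain w where w: "g = {w, z}" "w \<in> L"
      using less.prems(1)[of g] z(2) by auto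
    have gdeg: "edeg {#g#} v = of_bool (v = w) + of_bool (v = z)" for v
      using w z by auto
    show ?thesis
    proof (cases "edeg B w < edeg A w")
      case True
      then have "?Q A B x {#g#} {#f#} w" using f g w fdeg gdeg by auto
      then show ?thesis by blast
    next
      case nw: False
      define A1 B1 where "A1 = A - {#g#}" and "B1 = B - {#f#}"
      have A: "A = add_mset g A1" and B: "B = add_mset f B1"
        using f g by (auto simp: A1_def B1_def)
      have dA: "edeg A v = edeg A1 v + of_bool (v = w) + of_bool (v = z)" for v
        using gdeg[of v] by (simp add: A)
      have dB: "edeg B v = edeg B1 v + of_bool (v = x) + of_bool (v = z)" for v
        using fdeg[of v] by (simp add: B)
      have wz: "w \<noteq> z" "x \<noteq> z" using w z less.prems(2) by auto
      \<comment> \<open>Deleting \<open>g\<close> lowers the degree of \<open>w\<close> in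
        \<open>A\<close>. Its degree in \<open>B\<close> drops only if \<open>w = x\<close>, where
        \<open>B\<close> had the surplus to begin with. So the trail can be continued from
        \<open>w\<close>.\<close>
      have "edeg A1 w < edeg B1 w"
        using nw less.prems(3) dA[of w] dB[of w] dA[of x] dB[of x] wz by (cases "w = x") auto
      then have "\<exists>A' B' y. ?Q A1 B1 w A' B' y"
        using w(2) by (intro less.hyps less.prems(1)) (auto simp: A B)
      then obtain A' B' y where Q: "?Q A1 B1 w A' B' y" by blast
      have "?Q A B x (add_mset g A') (add_mset f B') y"
        using Q
      proof (elim conjE disjE, goal_cases)
        case 1
        \<comment> \<open>The trail cannot end at \<open>x\<close>: there \<open>B\<close> has the
          surplus, and removing \<open>f\<close> and \<open>g\<close> lowers it by at most
          one.\<close>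
        have "edeg B y < edeg A y"
          using 1 dA[of y] dB[of y] dA[of x] dB[of x] less.prems(3) wz by (cases "y = x") auto
        moreover have "edeg (add_mset f B') v + of_bool (v = y) = edeg (add_mset g A') v + of_bool (v = x)" for v
          using fdeg[of v] gdeg[of v] spec[OF 1(6), of v] by simp
        ultimately show ?case using 1 by (simp add: A B)
      next
        case 2
        have "edeg A y < edeg B y"
          using 2 dA[of y] dB[of y] w less.prems(2) by (auto simp: of_bool_def split: if_splits)
        moreover have "edeg (add_mset f B') v = edeg (add_mset g A') v + of_bool (v = x) + of_bool (v = y)" for v
          using fdeg[of v] gdeg[of v] spec[OF 2(6), of v] by simp
        ultimately show ?case using 2 by (simp add: A B)
      qed
      then show ?thesis by blast
    qed
  qed
qed

section \<open>Restrictions that a witness imposes on \<open>C\<close>\<close>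

lemma witness_independent:
  assumes "ass_witness E n C a" "d \<notin> C" "d' \<notin> C"
  shows "{d, d'} \<notin> E"
proof
  assume "{d, d'} \<in> E"
  \<comment> \<open>Copies of the edge alone make up the packing once the exponents outside
    \<open>C\<close> are raised by \<open>n\<close>.\<close>
  then have "fits E n (\<lambda>x. a x + (if x \<in> C then 0 else n))"
    using assms(2,3) by (intro fitsI[of "replicate_mset n {d, d'}"]) auto
  moreover have "\<not> fits E n (\<lambda>x. a x + (if x \<in> C then 0 else n))"
    using assms(1) unfolding ass_witness_def by (elim conjE allE[of _ "\<lambda>x. if x \<in> C then 0 else n"]) auto
  ultimately show False by simp
qed

text \<open>The part of \<open>C\<close> that matters for packings: any other vertex of
  \<open>C\<close> can be served by an edge to a neighbour outside \<open>C\<close>, where exponents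
  may be raised at will.\<close>

definition core :: "'v::finite set set \<Rightarrow> 'v set \<Rightarrow> 'v set" where
  "core E C = {v \<in> C. \<forall>d. d \<notin> C \<longrightarrow> {v, d} \<notin> E}"

text \<open>The unions of connected components of the graph induced on \<open>W\<close>.\<close>

definition adj_closed :: "'v::finite set set \<Rightarrow> 'v set \<Rightarrow> 'v set \<Rightarrow> bool" where
  "adj_closed E W K \<longleftrightarrow> K \<subseteq> W \<and> (\<forall>u\<in>K. \<forall>w\<in>W. {u, w} \<in> E \<longrightarrow> w \<in> K)"

definition two_colouring :: "'v::finite set set \<Rightarrow> 'v set \<Rightarrow> 'v set \<Rightarrow> bool" where
  "two_colouring E K L \<longleftrightarrow> (\<forall>u\<in>K. \<forall>w\<in>K. {u, w} \<in> E \<longrightarrow> (u \<in> L \<longleftrightarrow> w \<notin> L))"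

text \<open>
  If \<open>K\<close> were bipartite, then some maximum packing would leave room at \<open>x\<close> and another one at a
  neighbour \<open>y\<close> of \<open>x\<close>; the exchange lemma merges them into a packing to which \<open>xy\<close> can be added.
\<close>

lemma witness_not_two_colourable:
  assumes E: "simple_graph E" and wit: "ass_witness E n C a"
    and K: "adj_closed E (core E C) K" "K \<noteq> {}"
  shows "\<not> two_colouring E K L"
proof
  assume col: "two_colouring E K L"
  have KC: "K \<subseteq> core E C" "K \<subseteq> C" using K by (auto simp: adj_closed_def core_def)
  \<comment> \<open>Degrees outside \<open>C\<close> are unbounded because exponents there may be
    raised freely. Excluding edges across the boundary of \<open>K\<close> lets the exchange take
    place inside \<open>K\<close>.\<close>
  define good where "good M \<longleftrightarrow> set_mset M \<subseteq> E \<and> (\<forall>v\<in>C. edeg M v \<le> a v) \<and> (\<forall>e\<in>#M. e \<subseteq> K \<or> e \<inter> K = {})" for M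
  have max: "size M \<noteq> n" if "good M" for M
  proof
    assume "size M = n"
    then have "fits E n (\<lambda>x. a x + (if x \<in> C then 0 else n))"
      using that edeg_le_size[of M] by (intro fitsI[of M]) (auto simp: good_def intro: trans_le_add2)
    moreover have "\<not> fits E n (\<lambda>x. a x + (if x \<in> C then 0 else n))"
      using wit unfolding ass_witness_def by (elim conjE allE[of _ "\<lambda>x. if x \<in> C then 0 else n"]) auto
    ultimately show False by simp
  qed
  have room: "\<exists>y M. y \<in> K \<and> {v, y} \<in> E \<and> good M \<and> Suc (size M) = n \<and> edeg M y < a y" if v: "v \<in> K" for v
  proof -
    have "fits E n (\<lambda>x. a x + of_bool (x = v))" using wit v KC by (auto simp: ass_witness_def)
    then obtain M where M: "set_mset M \<subseteq> E" "size M = n" "\<And>x. edeg M x \<le> a x + of_bool (x = v)"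
      by (auto simp: fits_def)
    \<comment> \<open>An edge leaving \<open>K\<close> ends at a vertex \<open>p\<close> of
      \<open>C\<close> outside the core, which has a neighbour \<open>d\<close> outside
      \<open>C\<close>. Replacing the edge by \<open>{p, d}\<close> increases no degree on
      \<open>C\<close> and avoids \<open>K\<close>.\<close>
    have "\<exists>e'. e' \<in> E \<and> (\<forall>x\<in>C. x \<in> e' \<longrightarrow> x \<in> e) \<and> (e' \<subseteq> K \<or> e' \<inter> K = {})" if e: "e \<in> E" for e
    proof (cases "e \<subseteq> K \<or> e \<inter> K = {}")
      case False
      then obtain u where u: "u \<in> e" "u \<in> K" by blast
      obtain p where p: "e = {u, p}" by (rule simple_edge[OF E e u(1)])
      have uc: "u \<in> core E C" using KC(1) u(2) by (rule subsetD)
      have "p \<in> C" using uc e p by (auto simp: core_def)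
      moreover have "p \<notin> core E C" using K(1) u p e False by (auto simp: adj_closed_def)
      ultimately obtain d where d: "d \<notin> C" "{p, d} \<in> E" by (auto simp: core_def)
      have "p \<notin> K" "d \<notin> K" using KC \<open>p \<notin> core E C\<close> d(1) by blast+
      then show ?thesis using d p by (intro exI[of _ "{p, d}"]) simp
    next
      case True
      then show ?thesis using e by (intro exI[of _ e]) simp
    qed
    then obtain h where h: "\<And>e. e \<in> E \<Longrightarrow> h e \<in> E \<and> (\<forall>x\<in>C. x \<in> h e \<longrightarrow> x \<in> e) \<and> (h e \<subseteq> K \<or> h e \<inter> K = {})"
      by (metis (no_types, lifting))
    define M1 where "M1 = image_mset h M"
    have "set_mset M1 \<subseteq> E" "\<And>e. e \<in># M1 \<Longrightarrow> e \<subseteq> K \<or> e \<inter> K = {}" "size M1 = n"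
      using M h by (auto simp: M1_def)
    note M1 = this
    have "edeg (image_mset h N) x \<le> edeg N x" if "x \<in> C" "set_mset N \<subseteq> E" for x N
      using that(2) by (induction N) (use h that(1) in \<open>auto simp: of_bool_def\<close>)
    then have deg: "edeg M1 x \<le> a x + of_bool (x = v)" if "x \<in> C" for x
      using M that unfolding M1_def by (meson le_trans)
    \<comment> \<open>With \<open>n\<close> edges, \<open>M1\<close> must exceed \<open>a\<close>
      somewhere on \<open>C\<close>, and this is possible only at \<open>v\<close> and only by one.
      Deleting an edge at \<open>v\<close> repairs it and leaves room at the other end
      \<open>y\<close>.\<close>
    have "\<not> good M1" using max M1(3) by blast
    then obtain x where "x \<in> C" "edeg M1 x > a x" using M1 by (auto simp: good_def not_le)
    with deg have x: "edeg M1 v = Suc (a v)"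
      by (metis Suc_eq_plus1 le_SucE le_add_same_cancel1 leD of_bool_eq(1,2) add.right_neutral)
    then obtain e where e: "e \<in># M1" "v \<in> e" using edeg_pos[of M1 v] by auto
    then obtain y where y: "e = {v, y}" "v \<noteq> y" using simple_edge[OF E] M1(1) by blast
    then have yK: "y \<in> K" using M1(2)[OF e(1)] v by auto
    define M2 where "M2 = M1 - {#e#}"
    have M1': "M1 = add_mset e M2" using e by (simp add: M2_def)
    have "edeg M2 y < a y" using deg[of y] yK KC y by (auto simp: M1')
    moreover have "edeg M2 u \<le> a u" if "u \<in> C" for u
      using deg[OF that] x e(2) by (cases "u = v") (auto simp: M1')
    then have "good M2" using M1 by (auto simp: good_def M1')
    moreover have "{v, y} \<in> E" using M1(1) e y by auto
    ultimately show ?thesis using yK M1(3) by (intro exI[of _ y] exI[of _ M2]) (auto simp: M1')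
  qed
  obtain v where "v \<in> K" using K by auto
  from room[OF this] obtain y M2 where
    y: "y \<in> K" and M2: "good M2" "Suc (size M2) = n" "edeg M2 y < a y" by auto
  from room[OF y] obtain x M1 where x: "x \<in> K" "{y, x} \<in> E"
    and M1: "good M1" "Suc (size M1) = n" "edeg M1 x < a x" by auto
  define L' where "L' = (if x \<in> L then L else - L)"
  have col': "two_colouring E K L'" using col by (auto simp: two_colouring_def L'_def)
  have xX: "x \<in> L'" by (simp add: L'_def)
  then have yX: "y \<notin> L'" using col' x y by (auto simp: two_colouring_def)
  \<comment> \<open>With room at both ends, the edge \<open>{y, x}\<close> could be added to give a
    good packing of \<open>n\<close> edges.\<close>
  have noroom: "a x \<le> edeg M x" if "good M" "Suc (size M) = n" "edeg M y < a y" for M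
  proof (rule ccontr)
    assume "\<not> ?thesis"
    then have "good (add_mset {y, x} M)" using that x y by (auto simp: good_def of_bool_def)
    then show False using max[of "add_mset {y, x} M"] that(2) by simp
  qed
  define A B where "A = filter_mset (\<lambda>e. e \<subseteq> K) M1" and "B = filter_mset (\<lambda>e. e \<subseteq> K) M2"
  have degK: "edeg (filter_mset (\<lambda>e. e \<subseteq> K) M) v = edeg M v" if "good M" "v \<in> K" for M v
  proof -
    have "\<forall>e\<in>#M. e \<subseteq> K \<or> e \<inter> K = {}" using that(1) by (simp add: good_def)
    then show ?thesis using that(2) by (induction M) auto
  qed
  have "\<exists>p q. p \<in> L' \<and> q \<notin> L' \<and> e = {p, q}" if "e \<in># A + B" for e
  proof -
    have e: "e \<in> E" "e \<subseteq> K" using that M1(1) M2(1) by (auto simp: A_def B_def good_def)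
    then obtain p q where pq: "e = {p, q}" using simple_graphD[OF E] by (metis card_2_iff)
    then have "p \<in> L' \<longleftrightarrow> q \<notin> L'" using col' e by (auto simp: two_colouring_def)
    then show ?thesis using pq by (cases "p \<in> L'") (auto intro: exI[of _ p] exI[of _ q])
  qed
  \<comment> \<open>By \<open>noroom\<close>, \<open>M2\<close> fills \<open>x\<close> completely,
    whereas \<open>M1\<close> leaves room there.\<close>
  moreover have "edeg A x < edeg B x"
    unfolding A_def B_def degK[OF M1(1) x(1)] degK[OF M2(1) x(1)]
    using noroom[OF M2] M1(3) by simp
  ultimately obtain A' B' z where sub: "A' \<subseteq># A" "B' \<subseteq># B" and cases:
    "(z \<in> L' \<and> size B' = size A' \<and> edeg B z < edeg A z \<and>
        (\<forall>v. edeg B' v + of_bool (v = z) = edeg A' v + of_bool (v = x))) \<or>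
     (z \<notin> L' \<and> size B' = Suc (size A') \<and> edeg A z < edeg B z \<and>
        (\<forall>v. edeg B' v = edeg A' v + of_bool (v = x) + of_bool (v = z)))"
    using bipartite_exchange[of A B L' x] xX by blast
  have AM: "A \<subseteq># M1" and BM: "B \<subseteq># M2" by (auto simp: A_def B_def)
  have sub': "A' \<subseteq># M1" "B' \<subseteq># M2" using sub AM BM by (auto intro: subset_mset.trans)
  have KA: "v \<in> K" if "edeg A v > 0" for v using that by (auto simp: edeg_pos A_def)
  have KB: "v \<in> K" if "edeg B v > 0" for v using that by (auto simp: edeg_pos B_def)
  have goodI: "good M" if "\<And>v. v \<in> C \<Longrightarrow> edeg M v \<le> a v" "\<And>e. e \<in># M \<Longrightarrow> e \<in># M1 \<or> e \<in># M2" for M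
  proof -
    have "e \<in> E \<and> (e \<subseteq> K \<or> e \<inter> K = {})" if "e \<in># M" for e
      using \<open>\<And>e. e \<in># M \<Longrightarrow> e \<in># M1 \<or> e \<in># M2\<close>[OF that] M1(1) M2(1) by (auto simp: good_def)
    then show ?thesis using that(1) by (simp add: good_def subset_iff)
  qed
  from cases show False
  proof (elim disjE conjE, goal_cases)
    case 1
    \<comment> \<open>Even trail: one unit of degree moves from \<open>x\<close> to
      \<open>z\<close>, where \<open>M2\<close> had room because \<open>M1\<close> uses more. Now
      there is room at \<open>x\<close>, and still at \<open>y\<close>, which lies in the other
      colour class than \<open>x\<close> and \<open>z\<close>. This contradicts
      \<open>noroom\<close>.\<close>
    define M where "M = M2 - B' + A'"
    have deg: "edeg M v + of_bool (v = x) = edeg M2 v + of_bool (v = z)" for v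
      using spec[OF 1(4), of v] edeg_mono[OF sub'(2), of v] by (simp add: M_def edeg_diff[OF sub'(2)])
    have zK: "z \<in> K" using KA 1(3) by auto
    have z: "edeg M2 z < a z"
      using 1(3) subsetD[OF KC(2) zK] M1(1) degK[OF M1(1) zK] degK[OF M2(1) zK]
      by (auto simp: A_def B_def good_def dest!: bspec[of C _ z])
    have xz: "x \<noteq> z" using noroom[OF M2] z by auto
    have "edeg M v \<le> a v" if "v \<in> C" for v
    proof -
      have "edeg M2 v \<le> a v" using M2(1) that by (simp add: good_def)
      then show ?thesis using deg[of v] z by (cases "v = z"; cases "v = x") auto
    qed
    moreover have "e \<in># M \<Longrightarrow> e \<in># M1 \<or> e \<in># M2" for e
      using sub' unfolding M_def union_iff by (blast dest: in_diffD mset_subset_eqD)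
    ultimately have "good M" by (rule goodI)
    moreover have "size M = size M2"
      using 1(2) size_mset_mono[OF sub'(2)] by (simp add: M_def size_Diff_submset[OF sub'(2)])
    moreover have "edeg M y < a y"
      using deg[of y] M2(3) yX xX 1(1) by (auto split: if_splits simp: of_bool_def)
    ultimately have "a x \<le> edeg M x" using M2(2) by (intro noroom) auto
    moreover have "edeg M x < edeg M2 x" using deg[of x] xz by simp
    moreover have "edeg M2 x \<le> a x" using M2(1) subsetD[OF KC(2) x(1)] by (simp add: good_def)
    ultimately show ?case by simp
  next
    case 2
    \<comment> \<open>Odd trail: \<open>M1\<close> gains an edge, using its room at \<open>x\<close>
      and at \<open>z\<close>. The result is a good packing of \<open>n\<close> edges.\<close>
    define M where "M = M1 - A' + B'"
    have deg: "edeg M v = edeg M1 v + of_bool (v = x) + of_bool (v = z)" for v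
      using spec[OF 2(4), of v] edeg_mono[OF sub'(1), of v] by (simp add: M_def edeg_diff[OF sub'(1)])
    have zK: "z \<in> K" using KB 2(3) by auto
    have z: "edeg M1 z < a z"
      using 2(3) subsetD[OF KC(2) zK] M2(1) degK[OF M1(1) zK] degK[OF M2(1) zK]
      by (auto simp: A_def B_def good_def dest!: bspec[of C _ z])
    have xz: "x \<noteq> z" using xX 2(1) by auto
    have "edeg M v \<le> a v" if "v \<in> C" for v
    proof -
      have "edeg M1 v \<le> a v" using M1(1) that by (simp add: good_def)
      then show ?thesis using deg[of v] z M1(3) xz by (cases "v = z"; cases "v = x") auto
    qed
    moreover have "e \<in># M \<Longrightarrow> e \<in># M1 \<or> e \<in># M2" for e
      using sub' unfolding M_def union_iff by (blast dest: in_diffD mset_subset_eqD)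
    ultimately have "good M" by (rule goodI)
    moreover have "size M = n"
      using 2(2) M1(2) size_mset_mono[OF sub'(1)] by (simp add: M_def size_Diff_submset[OF sub'(1)])
    ultimately show ?case using max by blast
  qed
qed

section \<open>Walks and odd cycles\<close>

fun path_edges :: "'v list \<Rightarrow> 'v set set" where
  "path_edges (x # y # xs) = insert {x, y} (path_edges (y # xs))"
| "path_edges _ = {}"

lemma path_edges_append:
  "path_edges (xs @ ys) = path_edges xs \<union> path_edges ys \<union>
    (if xs = [] \<or> ys = [] then {} else {{last xs, hd ys}})"
proof (induction xs rule: path_edges.induct)
  case ("2_2" x)
  then show ?case by (cases ys) auto
qed auto

lemma path_edges_Cons:
  "path_edges (x # xs) = (if xs = [] then {} else {{x, hd xs}}) \<union> path_edges xs"
  by (cases xs) auto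

lemma path_edges_rev [simp]: "path_edges (rev xs) = path_edges xs"
  by (induction xs) (auto simp: path_edges_append path_edges_Cons last_rev insert_commute)

lemma path_edges_subset: "e \<in> path_edges xs \<Longrightarrow> e \<subseteq> set xs"
  by (induction xs rule: path_edges.induct) auto

lemma finite_path_edges [simp]: "finite (path_edges xs)"
  by (induction xs rule: path_edges.induct) auto

lemma card_path_edges: "distinct xs \<Longrightarrow> card (path_edges xs) = length xs - 1"
proof (induction xs rule: path_edges.induct)
  case (1 x y xs)
  then have "{x, y} \<notin> path_edges (y # xs)" using path_edges_subset[of "{x, y}" "y # xs"] by auto
  then show ?case using 1 by simp
qed auto

lemma path_edges_cover: "v \<in> set xs \<Longrightarrow> 2 \<le> length xs \<Longrightarrow> \<exists>e\<in>path_edges xs. v \<in> e"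
proof (induction xs rule: path_edges.induct)
  case (1 x y xs)
  then show ?case by (cases xs) auto
qed auto

lemma card_cycle_edges:
  assumes "distinct c" "3 \<le> length c"
  shows "card (path_edges (c @ [hd c])) = length c"
proof -
  obtain x y r where c: "c = x # y # r" "r \<noteq> []"
    using assms(2) by (cases c; cases "tl c"; cases "tl (tl c)") auto
  have "{last c, x} \<notin> path_edges c"
    using c assms(1) path_edges_subset[of "{last r, x}" "y # r"] by (auto simp: doubleton_eq_iff)
  moreover have "path_edges (c @ [hd c]) = insert {last c, x} (path_edges c)"
    using c by (subst path_edges_append) simp
  ultimately show ?thesis using c card_path_edges[OF assms(1)] by simp
qed

text \<open>An odd length below 3 would be 1, and the closing edge would then be a loop.\<close>

lemma closed_walk_is_cycle:
  assumes "simple_graph E" "path_edges (c @ [hd c]) \<subseteq> E" "distinct c" "odd (length c)"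
  shows "is_cycle E c"
proof -
  have "length c \<noteq> 1"
  proof
    assume "length c = 1"
    then obtain x where "c = [x]" by (auto simp: length_Suc_conv)
    then show False using simple_graphD[OF assms(1), of "{x}"] assms(2) by auto
  qed
  then have 3: "3 \<le> length c" using assms(4) by (cases "length c = 2") (auto simp: numeral_eq_Suc le_Suc_eq not_less_eq_eq intro: ccontr dest!: odd_pos)
  have nth: "{xs ! i, xs ! Suc i} \<in> path_edges xs" if "Suc i < length xs" for xs :: "'a list" and i
    using that
  proof (induction xs arbitrary: i rule: path_edges.induct)
    case (1 x y xs)
    then show ?case by (cases i) auto
  qed auto
  have "{c ! i, c ! (Suc i mod length c)} \<in> E" if "i < length c" for i
  proof (cases "Suc i = length c")
    case True
    then show ?thesis using nth[of i "c @ [hd c]"] assms(2) that hd_conv_nth[of c]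
      by (cases "c = []") (auto simp: nth_append)
  next
    case False
    then show ?thesis using nth[of i "c @ [hd c]"] assms(2) that by (auto simp: nth_append)
  qed
  then show ?thesis using 3 assms(3) by (simp add: is_cycle_def)
qed

text \<open>A repeated vertex splits the closed walk into two shorter closed walks, one of which has
  odd length.\<close>

lemma odd_closed_walk_contains_cycle:
  assumes "path_edges (c @ [hd c]) \<subseteq> E" "odd (length c)"
  shows "\<exists>c'. path_edges (c' @ [hd c']) \<subseteq> E \<and> odd (length c') \<and> distinct c' \<and> set c' \<subseteq> set c"
  using assms
proof (induction "length c" arbitrary: c rule: less_induct)
  case less
  show ?case
  proof (cases "distinct c")
    case False
    then obtain xs y ys zs where c: "c = xs @ [y] @ ys @ [y] @ zs"
      using not_distinct_decomp by blast
    have 1: "path_edges ((y # ys) @ [hd (y # ys)]) \<subseteq> E"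
      using less.prems(1) by (auto simp: c path_edges_append path_edges_Cons split: if_splits)
    have 2: "path_edges ((xs @ y # zs) @ [hd (xs @ y # zs)]) \<subseteq> E"
      using less.prems(1) by (cases xs) (auto simp: c path_edges_append path_edges_Cons split: if_splits)
    show ?thesis
    proof (cases "odd (length (y # ys))")
      case True
      from less.hyps[OF _ 1 True] show ?thesis by (auto simp: c)
    next
      case False
      then have odd: "odd (length (xs @ y # zs))" using less.prems(2) by (auto simp: c)
      from less.hyps[OF _ 2 odd] show ?thesis by (auto simp: c)
    qed
  qed (use less.prems in blast)
qed

text \<open>Connectedness of the graph induced on \<open>K\<close>, phrased so that every nonempty
  proper subset of \<open>K\<close> has an edge leaving it within \<open>K\<close>.\<close>

definition conn :: "'v::finite set set \<Rightarrow> 'v set \<Rightarrow> bool" where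
  "conn E K \<longleftrightarrow> K \<noteq> {} \<and> (\<forall>H. adj_closed E K H \<longrightarrow> H = {} \<or> H = K)"

lemma conn_boundary:
  assumes "conn E K" "S \<subset> K" "S \<noteq> {}"
  obtains u w where "u \<in> S" "w \<in> K" "w \<notin> S" "{u, w} \<in> E"
  using assms unfolding conn_def adj_closed_def by blast

lemma connected_graph_conn:
  assumes "connected_graph E"
  shows "conn E UNIV"
  unfolding conn_def
proof (intro conjI allI impI)
  fix H assume H: "adj_closed E UNIV H"
  show "H = {} \<or> H = UNIV"
  proof (cases "H = {}")
    case False
    then obtain u where u: "u \<in> H" by auto
    have "v \<in> H" for v
    proof -
      have "(u, v) \<in> (adj E)\<^sup>*" using assms by (simp add: connected_graph_def)
      then show ?thesis by induction (use u H in \<open>auto simp: adj_closed_def adj_def\<close>)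
    qed
    then show ?thesis by auto
  qed simp
qed simp

text \<open>Colour a vertex by whether some walk from a root reaches it with an odd number of
  vertices. As this is no two-colouring, some edge joins ends of equal colour; walks of equal parity
  to its ends close up to an odd closed walk.\<close>

lemma odd_cycle_exists:
  assumes E: "simple_graph E" and K: "conn E K" and col: "\<And>L. \<not> two_colouring E K L"
  obtains c where "is_cycle E c" "odd (length c)" "set c \<subseteq> K" "path_edges (c @ [hd c]) \<subseteq> E"
proof -
  obtain r where r: "r \<in> K" using K by (auto simp: conn_def)
  define walk where "walk v q \<longleftrightarrow> q \<noteq> [] \<and> hd q = r \<and> last q = v \<and> path_edges q \<subseteq> E \<and> set q \<subseteq> K" for v q
  have "adj_closed E K {v \<in> K. \<exists>q. walk v q}"
    unfolding adj_closed_def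
  proof (intro conjI ballI impI)
    fix u w assume u: "u \<in> {v \<in> K. \<exists>q. walk v q}" and w: "w \<in> K" "{u, w} \<in> E"
    then obtain q where "walk u q" by auto
    then have "walk w (q @ [w])" using w by (auto simp: walk_def path_edges_append)
    then show "w \<in> {v \<in> K. \<exists>q. walk v q}" using w by blast
  qed auto
  moreover have "walk r [r]" using r by (simp add: walk_def)
  ultimately have "{v \<in> K. \<exists>q. walk v q} = K" using K r unfolding conn_def by blast
  then have ex: "\<exists>q. walk v q" if "v \<in> K" for v using that by blast
  define L where "L = {v. \<exists>q. walk v q \<and> odd (length q)}"
  obtain u w where uw: "u \<in> K" "w \<in> K" "{u, w} \<in> E" "u \<in> L \<longleftrightarrow> w \<in> L"
    using col[of L] by (auto simp: two_colouring_def)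
  obtain p q where p: "walk u p" and q: "walk w q" and par: "even (length p) \<longleftrightarrow> even (length q)"
  proof (cases "u \<in> L")
    case True
    then show ?thesis using uw(4) that by (auto simp: L_def)
  next
    case False
    then show ?thesis using ex[OF uw(1)] ex[OF uw(2)] uw(4) that unfolding L_def by blast
  qed
  \<comment> \<open>The root starts both walks; \<open>tl\<close> drops its second copy, so the
    length is that of \<open>p\<close> plus that of \<open>q\<close> minus one, which is
    odd.\<close>
  define c where "c = p @ rev (tl q)"
  have cq: "c @ [hd c] = p @ rev q"
    using p q by (cases q) (auto simp: c_def walk_def)
  have "path_edges (c @ [hd c]) \<subseteq> E"
    unfolding cq using p q uw(3) by (auto simp: walk_def path_edges_append hd_rev)
  moreover have "odd (length c)"
    using p q par by (cases q) (auto simp: c_def walk_def)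
  ultimately obtain c' where c': "path_edges (c' @ [hd c']) \<subseteq> E" "odd (length c')" "distinct c'" "set c' \<subseteq> set c"
    using odd_closed_walk_contains_cycle by blast
  have "set c \<subseteq> K" using p q by (cases q) (auto simp: c_def walk_def)
  then show thesis using c' closed_walk_is_cycle[OF E c'(1,3,2)] by (intro that) auto
qed

section \<open>Critical exponent vectors\<close>

text \<open>
  A weighted version of factor-criticality: lowering a critical vector at any vertex of \<open>S\<close> leaves the
  degree sequence of a multiset of \<open>T\<close> edges.
\<close>

definition crit :: "'v::finite set set \<Rightarrow> 'v set \<Rightarrow> ('v \<Rightarrow> nat) \<Rightarrow> nat \<Rightarrow> bool" where
  "crit E S a T \<longleftrightarrow> (\<forall>v. v \<notin> S \<longrightarrow> a v = 0) \<and> (\<Sum>v\<in>UNIV. a v) = 2 * T + 1 \<and>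
     (\<forall>v\<in>S. \<exists>b. fits E T b \<and> (\<forall>x. b x + of_bool (x = v) \<le> a x))"

definition no_isolated :: "'v::finite set set \<Rightarrow> 'v set \<Rightarrow> bool" where
  "no_isolated E S \<longleftrightarrow> (\<forall>v\<in>S. \<exists>u\<in>S. {u, v} \<in> E)"

text \<open>Take every other edge of the walk, pairing the first vertex with the second, the third
  with the fourth, and so on.\<close>

lemma even_walk_fits:
  assumes "simple_graph E" "path_edges p \<subseteq> E" "even (length p)"
  shows "fits E (length p div 2) (count_list p)"
  using assms(2,3)
proof (induction p rule: induct_list012)
  case (3 x y zs)
  have "path_edges zs \<subseteq> E" using 3(3) by (auto simp: path_edges_Cons split: if_splits)
  then have "fits E (length zs div 2) (count_list zs)" using 3 by simp
  moreover have "{x, y} \<in> E" "x \<noteq> y"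
    using 3(3) simple_graphD[OF assms(1), of "{x, y}"] by auto
  then have "fits E 1 (\<lambda>v. of_bool (v \<in> {x, y}))"
    by (intro fitsI[of "{#{x, y}#}"]) auto
  ultimately have "fits E (length zs div 2 + 1) (\<lambda>v. count_list zs v + of_bool (v \<in> {x, y}))"
    by (rule fits_add)
  then show ?case using \<open>x \<noteq> y\<close> by (auto elim!: fits_mono)
qed (auto simp: fits_def)

lemma crit_singleton: "crit E {r} (\<lambda>x. of_bool (x = r)) 0"
  by (auto simp: crit_def fits_def intro!: exI[of _ "\<lambda>_. 0"])

text \<open>Attach an ear from \<open>u\<close> to \<open>z\<close>, possibly closed, with inner
  vertices \<open>ps\<close>. The vector gains one unit per inner vertex and, if their number is
  odd, one more at \<open>u\<close>, which keeps the total weight odd.\<close>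

lemma crit_ear:
  assumes E: "simple_graph E" and crit: "crit E S a T" and uz: "u \<in> S" "z \<in> S"
    and p: "path_edges (u # ps @ [z]) \<subseteq> E"
    and iso: "odd (length ps) \<Longrightarrow> no_isolated E S"
  shows "\<exists>a'. crit E (S \<union> set ps) a' (T + (length ps + 1) div 2)"
proof -
  define a' where "a' x = a x + count_list ps x + of_bool (odd (length ps) \<and> x = u)" for x
  \<comment> \<open>All cases below have this shape: an old packing together with alternate edges of
    up to three walks with evenly many vertices.\<close>
  have fit: "\<exists>b'. fits E (T + (length ps + 1) div 2) b' \<and> (\<forall>x. b' x + of_bool (x = v) \<le> a' x)"
    if b: "fits E T b" and p: "path_edges p \<subseteq> E" "path_edges q \<subseteq> E" "path_edges r \<subseteq> E"
      and even: "even (length p)" "even (length q)" "even (length r)"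
      and len: "length p + length q + length r = length ps + of_bool (odd (length ps))"
      and le: "\<And>x. b x + count_list p x + count_list q x + count_list r x + of_bool (x = v) \<le> a' x"
    for b p q r v
  proof (intro exI conjI allI)
    have "T + length p div 2 + length q div 2 + length r div 2 = T + (length ps + 1) div 2"
      using even len by (auto elim!: evenE split: if_splits simp: of_bool_def)
    moreover have "fits E (T + length p div 2 + length q div 2 + length r div 2)
        (\<lambda>x. b x + count_list p x + count_list q x + count_list r x)"
      by (intro fits_add b even_walk_fits[OF E] p even)
    ultimately show "fits E (T + (length ps + 1) div 2) (\<lambda>x. b x + count_list p x + count_list q x + count_list r x)"
      by (simp only:)
  qed (use le in auto)
  have old: "\<exists>b. fits E T b \<and> (\<forall>x. b x + of_bool (x = v) \<le> a x)" if "v \<in> S" for v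
    using crit that by (simp add: crit_def)
  have "\<exists>b. fits E (T + (length ps + 1) div 2) b \<and> (\<forall>x. b x + of_bool (x = v) \<le> a' x)"
    if v: "v \<in> S \<union> set ps" for v
  proof (cases "v \<in> S")
    case True
    from old[OF this] obtain b where b: "fits E T b" "\<And>x. b x + of_bool (x = v) \<le> a x" by auto
    show ?thesis
    proof (cases "even (length ps)")
      case True
      then show ?thesis using p b(2)
        by (intro fit[OF b(1), of ps "[]" "[]"]) (auto simp: path_edges_Cons path_edges_append a'_def add.assoc add.left_commute split: if_splits intro: le_trans)
    next
      case False
      then show ?thesis using p b(2)
        by (intro fit[OF b(1), of "u # ps" "[]" "[]"]) (auto simp: path_edges_Cons path_edges_append a'_def split: if_splits)
    qed
  next
    case False
    \<comment> \<open>Lowering at \<open>v\<close> cuts the ear into \<open>ys\<close> and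
      \<open>zs\<close>. A piece of odd length borrows its end \<open>u\<close> or \<open>z\<close>,
      whose unit comes from lowering the old vector there or from the extra unit at
      \<open>u\<close>.\<close>
    then obtain ys zs where ps: "ps = ys @ v # zs" using v by (auto dest: split_list)
    have w: "path_edges ys \<subseteq> E" "path_edges (u # ys) \<subseteq> E" "path_edges zs \<subseteq> E" "path_edges (zs @ [z]) \<subseteq> E"
      using p by (auto simp: ps path_edges_Cons path_edges_append split: if_splits)
    from old[OF uz(1)] obtain bu where bu: "fits E T bu" "\<And>x. bu x + of_bool (x = u) \<le> a x" by auto
    from old[OF uz(2)] obtain bz where bz: "fits E T bz" "\<And>x. bz x + of_bool (x = z) \<le> a x" by auto
    have cnt: "count_list ps x = count_list ys x + count_list zs x + of_bool (x = v)" for x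
      by (simp add: ps)
    show ?thesis
    proof (cases "even (length ys)"; cases "even (length zs)")
      assume par: "even (length ys)" "even (length zs)"
      then have "odd (length ps)" by (simp add: ps)
      \<comment> \<open>Neither piece needs an end, so the extra unit at \<open>u\<close> is matched
        with a neighbour \<open>t\<close> in \<open>S\<close>, freed by lowering the old vector at
        \<open>t\<close>.\<close>
      from iso[OF this] uz obtain t where t: "t \<in> S" "{t, u} \<in> E" by (auto simp: no_isolated_def)
      from old[OF t(1)] obtain bt where bt: "fits E T bt" "\<And>x. bt x + of_bool (x = t) \<le> a x" by auto
      show ?thesis
      proof (rule fit[OF bt(1) _ w(1) w(3)])
        show "path_edges [t, u] \<subseteq> E" using t by simp
        show "bt x + count_list [t, u] x + count_list ys x + count_list zs x + of_bool (x = v) \<le> a' x" for x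
          using bt(2)[of x] par cnt[of x] by (auto simp: a'_def ps)
      qed (use par in \<open>auto simp: ps\<close>)
    next
      assume par: "even (length ys)" "odd (length zs)"
      show ?thesis
      proof (rule fit[OF bz(1) w(1) w(4), of "[]"])
        fix x
        show "bz x + count_list ys x + count_list (zs @ [z]) x + count_list [] x + of_bool (x = v) \<le> a' x"
          using bz(2)[of x] par cnt[of x] by (auto simp: a'_def)
      qed (use par in \<open>auto simp: ps\<close>)
    next
      assume par: "odd (length ys)" "even (length zs)"
      show ?thesis
      proof (rule fit[OF bu(1) w(2) w(3), of "[]"])
        fix x
        show "bu x + count_list (u # ys) x + count_list zs x + count_list [] x + of_bool (x = v) \<le> a' x"
          using bu(2)[of x] par cnt[of x] by (auto simp: a'_def)
      qed (use par in \<open>auto simp: ps\<close>)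
    next
      \<comment> \<open>The extra unit at \<open>u\<close> completes the first piece, so the old
        vector is lowered at \<open>z\<close> only.\<close>
      assume par: "odd (length ys)" "odd (length zs)"
      show ?thesis
      proof (rule fit[OF bz(1) w(2) w(4), of "[]"])
        fix x
        show "bz x + count_list (u # ys) x + count_list (zs @ [z]) x + count_list [] x + of_bool (x = v) \<le> a' x"
          using bz(2)[of x] par cnt[of x] by (auto simp: a'_def ps)
      qed (use par in \<open>auto simp: ps\<close>)
    qed
  qed
  moreover have "(\<Sum>v\<in>UNIV. a' v) = 2 * (T + (length ps + 1) div 2) + 1"
  proof -
    have "(\<Sum>v\<in>UNIV. a' v) = (\<Sum>v\<in>UNIV. a v) + length ps + of_bool (odd (length ps))"
      unfolding a'_def by (simp add: sum.distrib sum_count_set of_bool_conj flip: sum_distrib_left)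
    then show ?thesis using crit by (auto simp: crit_def elim!: evenE oddE)
  qed
  moreover have "\<forall>v. v \<notin> S \<union> set ps \<longrightarrow> a' v = 0"
    using crit uz by (auto simp: crit_def a'_def)
  ultimately show ?thesis unfolding crit_def by blast
qed

text \<open>Each edge consumes two units, and the total weight is only 2T + 1.\<close>

lemma crit_fits_le:
  assumes E: "simple_graph E" and crit: "crit E S a T"
    and M: "set_mset M \<subseteq> E" "\<And>x. edeg M x \<le> a x"
  shows "size M \<le> T"
proof -
  have "2 * size M = (\<Sum>v\<in>UNIV. edeg M v)"
    by (rule sum_edeg[symmetric]) (use M(1) in \<open>blast intro: simple_graphD[OF E]\<close>)
  also have "\<dots> \<le> (\<Sum>v\<in>UNIV. a v)" by (simp add: M(2) sum_mono)
  finally show ?thesis using crit by (simp add: crit_def)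
qed

lemma critE:
  assumes "crit E S a T" "v \<in> S"
  obtains b where "fits E T b" "\<And>x. b x + of_bool (x = v) \<le> a x"
proof -
  have "\<exists>b. fits E T b \<and> (\<forall>x. b x + of_bool (x = v) \<le> a x)"
    using assms by (simp add: crit_def)
  then show thesis using that by auto
qed

lemma fits_one_edge:
  assumes "e \<in> E"
  shows "fits E 1 (\<lambda>x. of_bool (x \<in> e))"
  using assms by (intro fitsI[of "{#e#}"]) auto

lemma crit_add_edge:
  assumes E: "simple_graph E" and crit: "crit E S a T" and e: "{p, q} \<in> E" "p \<in> S" "q \<in> S"
  shows "crit E S (\<lambda>x. a x + of_bool (x \<in> {p, q})) (Suc T)"
proof -
  have "p \<noteq> q" using simple_graphD[OF E e(1)] by auto
  then have "(\<Sum>x\<in>UNIV. of_bool (x \<in> {p, q})) = (2 :: nat)"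
    using sum_edeg[of "{#{p, q}#}"] by simp
  then have "(\<Sum>x\<in>UNIV. a x + of_bool (x \<in> {p, q})) = 2 * Suc T + 1"
    using crit by (simp add: sum.distrib crit_def del: insert_iff)
  moreover have "\<exists>b. fits E (Suc T) b \<and> (\<forall>x. b x + of_bool (x = v) \<le> a x + of_bool (x \<in> {p, q}))"
    if "v \<in> S" for v
  proof -
    obtain b where T: "fits E T b" and b: "\<And>x. b x + of_bool (x = v) \<le> a x"
      by (rule critE[OF crit \<open>v \<in> S\<close>]) (rule that)
    have "fits E (T + 1) (\<lambda>x. b x + of_bool (x \<in> {p, q}))"
      by (rule fits_add[OF T fits_one_edge[OF e(1)]])
    then show ?thesis using b by (intro exI[of _ "\<lambda>x. b x + of_bool (x \<in> {p, q})"]) auto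
  qed
  moreover have "a v + of_bool (v \<in> {p, q}) = 0" if "v \<notin> S" for v
    using crit e that by (auto simp: crit_def)
  ultimately show ?thesis unfolding crit_def by blast
qed

text \<open>One more unit at both ends of an edge inside \<open>S\<close> raises \<open>T\<close> by
  one.\<close>

lemma crit_increase:
  assumes "simple_graph E" "no_isolated E S" "S \<noteq> {}" "crit E S a T" "T \<le> T'"
  shows "\<exists>a'. crit E S a' T'"
  using assms(5)
proof (induction rule: dec_induct)
  case (step n)
  obtain q where q: "q \<in> S" using assms(3) by auto
  then obtain p where p: "p \<in> S" "{p, q} \<in> E" using assms(2) by (auto simp: no_isolated_def)
  obtain a' where "crit E S a' n" using step.IH by blast
  from crit_add_edge[OF assms(1) this p(2,1) q] show ?case
    by (rule exI[where P = "\<lambda>a. crit E S a (Suc n)"])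
next
  case base
  show ?case using assms(4) by (rule exI[where P = "\<lambda>a. crit E S a T"])
qed

section \<open>Critical vectors on cycles and connected vertex sets\<close>

lemma no_isolated_walk:
  assumes "simple_graph E" "path_edges q \<subseteq> E" "2 \<le> length q"
  shows "no_isolated E (set q)"
  unfolding no_isolated_def
proof
  fix v assume "v \<in> set q"
  then obtain e where e: "e \<in> path_edges q" "v \<in> e" using path_edges_cover assms(3) by metis
  then obtain w where "e = {v, w}" using simple_edge[OF assms(1)] assms(2) by blast
  then show "\<exists>u\<in>set q. {u, v} \<in> E"
    using e(1) assms(2) path_edges_subset[OF e(1)] by (intro bexI[of _ w]) (auto simp: insert_commute)
qed

lemma no_isolated_Un: "no_isolated E S \<Longrightarrow> no_isolated E S' \<Longrightarrow> no_isolated E (S \<union> S')"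
  unfolding no_isolated_def by blast

lemma no_isolated_insert:
  assumes "no_isolated E S" "u \<in> S" "{u, w} \<in> E"
  shows "no_isolated E (S \<union> {w})"
  unfolding no_isolated_def
proof
  fix v assume "v \<in> S \<union> {w}"
  then show "\<exists>u\<in>S \<union> {w}. {u, v} \<in> E"
    using assms unfolding no_isolated_def by (cases "v = w") auto
qed

text \<open>An odd closed walk is a closed ear on its first vertex with an even number of inner
  vertices.\<close>

lemma crit_cycle:
  assumes "simple_graph E" "path_edges (c @ [hd c]) \<subseteq> E" "odd (length c)"
  shows "\<exists>a. crit E (set c) a (length c div 2)"
proof -
  obtain r ps where c: "c = r # ps" using assms(3) by (cases c) auto
  have "\<exists>a'. crit E ({r} \<union> set ps) a' (0 + (length ps + 1) div 2)"
    using assms by (intro crit_ear[OF assms(1) crit_singleton]) (auto simp: c)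
  then show ?thesis by (simp add: c)
qed

lemma grow_to:
  fixes K :: "'a::finite set"
  assumes "P S" "S \<subseteq> K" "\<And>S. P S \<Longrightarrow> S \<subset> K \<Longrightarrow> \<exists>S'. S \<subset> S' \<and> S' \<subseteq> K \<and> P S'"
  shows "P K"
  using assms(1,2)
proof (induction "card (K - S)" arbitrary: S rule: less_induct)
  case less
  show ?case
  proof (cases "S = K")
    case False
    then have "S \<subset> K" using less.prems(2) by auto
    from assms(3)[OF less.prems(1) this] obtain S' where S': "S \<subset> S'" "S' \<subseteq> K" "P S'" by auto
    then have "card (K - S') < card (K - S)" by (intro psubset_card_mono) auto
    from less.hyps[OF this S'(3,2)] show ?thesis .
  qed (use less.prems in simp)
qed

lemma card_edges_add:
  fixes F G :: "'v::finite set set"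
  assumes "F \<subseteq> E \<inter> Pow S" "G \<subseteq> E" "\<And>e. e \<in> G \<Longrightarrow> \<not> e \<subseteq> S"
  shows "card (F \<union> G) = card F + card G"
  using assms by (intro card_Un_disjoint) auto

text \<open>Account for \<open>T\<close> by the edges \<open>F\<close> spent so far. An odd cycle of
  length l gives T = (l - 1) / 2, which is at most l - k by the girth bound; each further vertex
  costs one edge and raises \<open>T\<close> by one. Hence \<open>T + k\<close> never exceeds
  \<open>card F\<close>, and larger values of \<open>T\<close> come from
  \<open>crit_increase\<close>.\<close>

lemma component_crit:
  fixes E :: "'v::finite set set"
  assumes E: "simple_graph E" and K: "conn E K" and col: "\<And>L. \<not> two_colouring E K L"
    and girth: "\<And>c. is_cycle E c \<Longrightarrow> odd (length c) \<Longrightarrow> 2 * k \<le> length c + 1"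
    and T: "card (E \<inter> Pow K) \<le> T + k"
  shows "\<exists>a. crit E K a T"
proof -
  define P where "P S \<longleftrightarrow> S \<noteq> {} \<and> no_isolated E S \<and>
    (\<exists>a T F. crit E S a T \<and> F \<subseteq> E \<inter> Pow S \<and> T + k \<le> card F)" for S
  obtain c where c: "is_cycle E c" "odd (length c)" "set c \<subseteq> K" "path_edges (c @ [hd c]) \<subseteq> E"
    by (rule odd_cycle_exists[OF E K col])
  have len: "3 \<le> length c" "distinct c" using c(1) by (auto simp: is_cycle_def)
  have sub: "path_edges c \<subseteq> E" using c(4) by (auto simp: path_edges_append)
  obtain a where "crit E (set c) a (length c div 2)" using crit_cycle[OF E c(4,2)] by blast
  moreover have "path_edges (c @ [hd c]) \<subseteq> E \<inter> Pow (set c)"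
    using c(4) path_edges_subset[of _ "c @ [hd c]"] len by (cases c) auto
  moreover have "length c div 2 + k \<le> card (path_edges (c @ [hd c]))"
    using girth[OF c(1,2)] c(2) card_cycle_edges[OF len(2,1)] by (auto elim!: oddE)
  moreover have "no_isolated E (set c)" using no_isolated_walk[OF E sub] len by simp
  moreover have "set c \<noteq> {}" using len by auto
  ultimately have "P (set c)" unfolding P_def by blast
  then have "P K"
  proof (rule grow_to[OF _ c(3)])
    fix S assume S: "P S" "S \<subset> K"
    then obtain a T F where crit: "crit E S a T" and F: "F \<subseteq> E \<inter> Pow S" "T + k \<le> card F"
      and iso: "no_isolated E S" and ne: "S \<noteq> {}" by (auto simp: P_def)
    obtain u w where uw: "u \<in> S" "w \<in> K" "w \<notin> S" "{u, w} \<in> E"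
      by (rule conn_boundary[OF K S(2) ne])
    \<comment> \<open>The closed ear u, w, u runs along one edge there and back.\<close>
    have "\<exists>a'. crit E (S \<union> set [w]) a' (T + (length [w] + 1) div 2)"
      using uw iso by (intro crit_ear[OF E crit uw(1) uw(1)]) (auto simp: insert_commute)
    then obtain a' where a': "crit E (S \<union> {w}) a' (T + 1)" by auto
    have "card (F \<union> {{u, w}}) = card F + card {{u, w}}"
      using F uw by (intro card_edges_add[where E = E and S = S]) auto
    then have "T + 1 + k \<le> card (F \<union> {{u, w}})" using F(2) by simp
    moreover have "F \<union> {{u, w}} \<subseteq> E \<inter> Pow (S \<union> {w})" using F uw by auto
    moreover have "no_isolated E (S \<union> {w})" using iso uw by (intro no_isolated_insert)
    ultimately have "P (S \<union> {w})" using a' unfolding P_def by blast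
    then show "\<exists>S'. S \<subset> S' \<and> S' \<subseteq> K \<and> P S'" using uw S(2) by (intro exI[of _ "S \<union> {w}"]) auto
  qed
  then obtain a T0 F where crit: "crit E K a T0" and F: "F \<subseteq> E \<inter> Pow K" "T0 + k \<le> card F"
    and iso: "no_isolated E K" and ne: "K \<noteq> {}" by (auto simp: P_def)
  have "card F \<le> card (E \<inter> Pow K)" using F(1) by (intro card_mono) auto
  then show ?thesis using crit_increase[OF E iso ne crit] F(2) T by simp
qed

subsection \<open>Ear decompositions\<close>

text \<open>Deleting a non-bridge from a connected graph leaves at most one component, so the
  classes of \<open>u\<close> and \<open>v\<close> coincide.\<close>

lemma nonbridge_reachable:
  fixes E :: "'v::finite set set"
  assumes "connected_graph E" "e \<in> E" "e \<notin> bridges E"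
  shows "(u, v) \<in> (adj (E - {e}))\<^sup>*"
proof -
  let ?R = "(adj (E - {e}))\<^sup>*"
  have "(adj E)\<^sup>* = UNIV" using assms(1) by (auto simp: connected_graph_def)
  then have "components E = {UNIV}" by (auto simp: components_def quotient_def)
  then have "card (components (E - {e})) \<le> Suc 0"
    using assms(2,3) by (auto simp: bridges_def not_less)
  moreover have "?R `` {u} \<in> components (E - {e})" "?R `` {v} \<in> components (E - {e})"
    by (auto simp: components_def quotient_def)
  ultimately have "?R `` {u} = ?R `` {v}"
    by (simp add: card_le_Suc0_iff_eq)
  then show ?thesis by auto
qed

text \<open>Built backwards along the walk, restarting whenever the walk meets \<open>S\<close>. If
  the new vertex already lies on the path, everything before it is cut off, which keeps the path
  simple.\<close>

lemma first_return_path: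
  assumes "(w, u) \<in> (adj F)\<^sup>*" "u \<in> S" "w \<notin> S"
  shows "\<exists>ps z. z \<in> S \<and> ps \<noteq> [] \<and> hd ps = w \<and> distinct ps \<and> set ps \<inter> S = {} \<and> path_edges (ps @ [z]) \<subseteq> F"
  using assms(1,3)
proof (induction rule: converse_rtrancl_induct)
  case base
  then show ?case using assms(2) by simp
next
  case (step w w')
  show ?case
  proof (cases "w' \<in> S")
    case True
    then show ?thesis using step by (intro exI[of _ "[w]"] exI[of _ w']) (auto simp: adj_def)
  next
    case False
    then obtain ps z where ps: "z \<in> S" "ps \<noteq> []" "hd ps = w'" "distinct ps" "set ps \<inter> S = {}"
      "path_edges (ps @ [z]) \<subseteq> F" using step by blast
    show ?thesis
    proof (cases "w \<in> set ps")
      case True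
      then obtain ys zs where "ps = ys @ w # zs" by (auto dest: split_list)
      then show ?thesis using ps by (intro exI[of _ "w # zs"] exI[of _ z]) (auto simp: path_edges_append)
    next
      case False
      then show ?thesis using ps step
        by (intro exI[of _ "w # ps"] exI[of _ z]) (auto simp: path_edges_Cons adj_def)
    qed
  qed
qed

text \<open>Again \<open>F\<close> records the edges spent. An ear with l edges raises 2T by at most
  l. A bridge used there and back raises 2T by 2, which is paid for by counting bridges
  twice.\<close>

lemma spanning_crit:
  fixes E :: "'v::finite set set"
  assumes E: "simple_graph E" and conn: "connected_graph E" and col: "\<And>L. \<not> two_colouring E UNIV L"
  shows "\<exists>a T. crit E UNIV a T \<and> 2 * T \<le> card E + num_bridges E \<and> no_isolated E UNIV"
proof -
  define P where "P S \<longleftrightarrow> S \<noteq> {} \<and> no_isolated E S \<and>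
    (\<exists>a T F. crit E S a T \<and> F \<subseteq> E \<inter> Pow S \<and> 2 * T \<le> card F + card (F \<inter> bridges E))" for S
  have K: "conn E UNIV" by (rule connected_graph_conn[OF conn])
  obtain c where c: "is_cycle E c" "odd (length c)" "path_edges (c @ [hd c]) \<subseteq> E"
    by (rule odd_cycle_exists[OF E K col])
  have len: "3 \<le> length c" "distinct c" using c(1) by (auto simp: is_cycle_def)
  have sub: "path_edges c \<subseteq> E" using c(3) by (auto simp: path_edges_append)
  obtain a where "crit E (set c) a (length c div 2)" using crit_cycle[OF E c(3,2)] by blast
  \<comment> \<open>The cycle without its closing edge already pays: for length l, 2T = l -
    1.\<close>
  moreover have "path_edges c \<subseteq> E \<inter> Pow (set c)"
    using sub path_edges_subset by blast
  moreover have "2 * (length c div 2) \<le> card (path_edges c) + card (path_edges c \<inter> bridges E)"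
    using c(2) card_path_edges[OF len(2)] by (auto elim!: oddE)
  moreover have "no_isolated E (set c)" using no_isolated_walk[OF E sub] len by simp
  moreover have "set c \<noteq> {}" using len by auto
  ultimately have "P (set c)" unfolding P_def by blast
  then have "P UNIV"
  proof (rule grow_to[OF _ subset_UNIV])
    fix S assume S: "P S" "S \<subset> UNIV"
    then obtain a T F where crit: "crit E S a T" and F: "F \<subseteq> E \<inter> Pow S" "2 * T \<le> card F + card (F \<inter> bridges E)"
      and iso: "no_isolated E S" and ne: "S \<noteq> {}" by (auto simp: P_def)
    obtain u w where uw: "u \<in> S" "w \<notin> S" "{u, w} \<in> E"
      by (rule conn_boundary[OF K S(2) ne])
    show "\<exists>S'. S \<subset> S' \<and> S' \<subseteq> UNIV \<and> P S'"
    proof (cases "{u, w} \<in> bridges E")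
      case True
      have "\<exists>a'. crit E (S \<union> set [w]) a' (T + (length [w] + 1) div 2)"
        using uw iso by (intro crit_ear[OF E crit uw(1) uw(1)]) (auto simp: insert_commute)
      then obtain a' where a': "crit E (S \<union> {w}) a' (T + 1)" by auto
      have "card (F \<union> {{u, w}}) = card F + card {{u, w}}"
        using F uw by (intro card_edges_add[where E = E and S = S]) auto
      moreover have "card (F \<inter> bridges E \<union> {{u, w}}) = card (F \<inter> bridges E) + card {{u, w}}"
        using F uw by (intro card_edges_add[where E = E and S = S]) auto
      moreover have "(F \<union> {{u, w}}) \<inter> bridges E = F \<inter> bridges E \<union> {{u, w}}" using True by auto
      ultimately have "2 * (T + 1) \<le> card (F \<union> {{u, w}}) + card ((F \<union> {{u, w}}) \<inter> bridges E)"
        using F(2) by simp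
      moreover have "F \<union> {{u, w}} \<subseteq> E \<inter> Pow (S \<union> {w})" using F uw by auto
      moreover have "no_isolated E (S \<union> {w})" using iso uw by (intro no_isolated_insert)
      ultimately have "P (S \<union> {w})" using a' unfolding P_def by blast
      then show ?thesis using uw by (intro exI[of _ "S \<union> {w}"]) auto
    next
      case False
      \<comment> \<open>As the edge is not a bridge, \<open>w\<close> has a way back to
        \<open>S\<close> avoiding it; edge and path together form an ear, closed if
        \<open>z = u\<close>.\<close>
      obtain ps z where ps: "z \<in> S" "ps \<noteq> []" "hd ps = w" "distinct ps" "set ps \<inter> S = {}"
        "path_edges (ps @ [z]) \<subseteq> E - {{u, w}}"
        using first_return_path[OF nonbridge_reachable[OF conn uw(3) False] uw(1,2)] by blast
      define G where "G = path_edges (u # ps @ [z])"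
      have G: "G = insert {u, w} (path_edges (ps @ [z]))" using ps by (simp add: G_def path_edges_Cons)
      have GE: "G \<subseteq> E" using ps uw by (auto simp: G)
      obtain a' where a': "crit E (S \<union> set ps) a' (T + (length ps + 1) div 2)"
        using crit_ear[OF E crit uw(1) ps(1) GE[unfolded G_def] iso] by blast
      \<comment> \<open>Since \<open>u\<close> and \<open>z\<close> may coincide, the edge
        \<open>{u, w}\<close> is counted apart from the simple path.\<close>
      have "distinct (ps @ [z])" using ps by auto
      moreover have "{u, w} \<notin> path_edges (ps @ [z])" using ps(6) by auto
      ultimately have cG: "card G = length ps + 1" by (simp add: G card_path_edges)
      have new: "\<not> e \<subseteq> S" if "e \<in> G" for e
      proof -
        have "e = {u, w} \<or> e \<in> path_edges ps \<or> e = {last ps, z}"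
          using that ps(2) by (auto simp: G path_edges_append)
        moreover have "e \<noteq> {}" using GE that simple_graphD[OF E, of e] by auto
        ultimately show ?thesis using uw(2) ps(2,5) path_edges_subset[of e ps] last_in_set[OF ps(2)] by blast
      qed
      have "card (F \<union> G) = card F + card G" by (rule card_edges_add[OF F(1) GE new])
      moreover have "card (F \<inter> bridges E) \<le> card ((F \<union> G) \<inter> bridges E)" by (intro card_mono) auto
      ultimately have "2 * (T + (length ps + 1) div 2) \<le> card (F \<union> G) + card ((F \<union> G) \<inter> bridges E)"
        using F(2) cG by simp
      moreover have "e \<subseteq> S \<union> set ps" if "e \<in> G" for e
        using path_edges_subset[of e "u # ps @ [z]"] that uw(1) ps(1) by (auto simp: G_def)
      then have "F \<union> G \<subseteq> E \<inter> Pow (S \<union> set ps)" using F(1) GE by blast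
      moreover have "no_isolated E (S \<union> set ps)"
      proof -
        have "path_edges (u # ps) \<subseteq> G" by (auto simp: G_def path_edges_append simp flip: append_Cons)
        then have "no_isolated E (set (u # ps))"
          using GE ps(2) by (intro no_isolated_walk[OF E]) (auto simp: Suc_le_eq)
        from no_isolated_Un[OF iso this] uw(1) show ?thesis by (simp add: insert_absorb)
      qed
      ultimately have "P (S \<union> set ps)" using a' ne unfolding P_def by blast
      moreover have "w \<in> set ps" using ps(2,3) by auto
      ultimately show ?thesis using uw(2) by (intro exI[of _ "S \<union> set ps"]) auto
    qed
  qed
  then obtain a T F where crit: "crit E UNIV a T" and F: "F \<subseteq> E" "2 * T \<le> card F + card (F \<inter> bridges E)"
    and iso: "no_isolated E UNIV" by (auto simp: P_def)
  have "card F \<le> card E" "card (F \<inter> bridges E) \<le> card (bridges E)"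
    using F(1) by (auto intro: card_mono)
  then show ?thesis using crit F(2) iso unfolding num_bridges_def by (intro exI[of _ a] exI[of _ T]) simp
qed

section \<open>Constructing witnesses\<close>

text \<open>Like \<open>crit\<close>, but the weight condition is replaced by its consequence that
  at most \<open>T\<close> edges fit. Unlike weight 2T + 1, this form is additive over
  components.\<close>

definition packing :: "'v::finite set set \<Rightarrow> 'v set \<Rightarrow> nat \<Rightarrow> ('v \<Rightarrow> nat) \<Rightarrow> bool" where
  "packing E W T a \<longleftrightarrow> (\<forall>v. v \<notin> W \<longrightarrow> a v = 0) \<and>
     (\<forall>v\<in>W. \<exists>b. fits E T b \<and> (\<forall>x. b x + of_bool (x = v) \<le> a x)) \<and>
     (\<forall>M. set_mset M \<subseteq> E \<longrightarrow> (\<forall>x. edeg M x \<le> a x) \<longrightarrow> size M \<le> T)"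

lemma crit_packing:
  assumes "simple_graph E" "crit E S a T"
  shows "packing E S T a"
  using assms crit_fits_le[OF assms] by (simp add: packing_def crit_def)

lemma packingE:
  assumes "packing E W T a" "v \<in> W"
  obtains b where "fits E T b" "\<And>x. b x + of_bool (x = v) \<le> a x"
proof -
  have "\<exists>b. fits E T b \<and> (\<forall>x. b x + of_bool (x = v) \<le> a x)"
    using assms by (simp add: packing_def)
  then show thesis using that by auto
qed

lemma packing_size:
  "packing E W T a \<Longrightarrow> set_mset M \<subseteq> E \<Longrightarrow> (\<And>x. edeg M x \<le> a x) \<Longrightarrow> size M \<le> T"
  by (simp add: packing_def)

lemma packing_fits:
  assumes "packing E W T a" "W \<noteq> {}"
  shows "fits E T a"
proof -
  obtain v where "v \<in> W" using assms(2) by auto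
  obtain b where b: "fits E T b" "\<And>x. b x + of_bool (x = v) \<le> a x"
    by (rule packingE[OF assms(1) \<open>v \<in> W\<close>]) (rule that)
  show ?thesis by (rule fits_mono[OF b(1)]) (use b(2) in \<open>auto dest: add_leD1\<close>)
qed

text \<open>A vertex is lowered in one part while the other part keeps a full packing. For the upper
  bound, no edge joins the parts, so a packing below the sum splits into one for each.\<close>

lemma packing_Un:
  assumes E: "simple_graph E"
    and H: "packing E H T a" "H \<noteq> {}" and H': "packing E H' T' a'" "H' \<noteq> {}"
    and disj: "H \<inter> H' = {}" and noedge: "\<And>u w. u \<in> H \<Longrightarrow> w \<in> H' \<Longrightarrow> {u, w} \<notin> E"
  shows "packing E (H \<union> H') (T + T') (\<lambda>x. a x + a' x)"
  unfolding packing_def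
proof (intro conjI allI ballI impI)
  fix v assume "v \<notin> H \<union> H'"
  then show "a v + a' v = 0" using H H' by (simp add: packing_def)
next
  fix v assume v: "v \<in> H \<union> H'"
  show "\<exists>b. fits E (T + T') b \<and> (\<forall>x. b x + of_bool (x = v) \<le> a x + a' x)"
  proof (cases "v \<in> H")
    case True
    obtain b where b: "fits E T b" "\<And>x. b x + of_bool (x = v) \<le> a x"
      by (rule packingE[OF H(1) True]) (rule that)
    show ?thesis
    proof (intro exI conjI allI)
      show "fits E (T + T') (\<lambda>x. b x + a' x)" by (rule fits_add[OF b(1) packing_fits[OF H']])
      show "b x + a' x + of_bool (x = v) \<le> a x + a' x" for x using b(2)[of x] by simp
    qed
  next
    case False
    then have "v \<in> H'" using v by simp
    obtain b where b: "fits E T' b" "\<And>x. b x + of_bool (x = v) \<le> a' x"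
      by (rule packingE[OF H'(1) \<open>v \<in> H'\<close>]) (rule that)
    show ?thesis
    proof (intro exI conjI allI)
      show "fits E (T + T') (\<lambda>x. a x + b x)" by (rule fits_add[OF packing_fits[OF H] b(1)])
      show "a x + b x + of_bool (x = v) \<le> a x + a' x" for x using b(2)[of x] by simp
    qed
  qed
next
  fix M assume M: "set_mset M \<subseteq> E" "\<forall>x. edeg M x \<le> a x + a' x"
  have supp: "a x = 0" if "x \<notin> H" for x using H(1) that by (simp add: packing_def)
  have supp': "a' x = 0" if "x \<notin> H'" for x using H'(1) that by (simp add: packing_def)
  define N N' where "N = filter_mset (\<lambda>e. e \<subseteq> H) M" and "N' = filter_mset (\<lambda>e. \<not> e \<subseteq> H) M"
  have MN: "M = N + N'" by (simp add: N_def N'_def)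
  have side: "e \<subseteq> H \<or> e \<subseteq> H'" if e: "e \<in># M" for e
  proof -
    have eE: "e \<in> E" using M(1) e by auto
    then obtain p q where pq: "e = {p, q}" using simple_graphD[OF E] by (metis card_2_iff)
    have "x \<in> H \<union> H'" if "x \<in> e" for x
    proof -
      have "0 < edeg M x" using e that by (auto simp: edeg_pos)
      moreover have "edeg M x \<le> a x + a' x" using M(2) by blast
      ultimately have "0 < a x + a' x" by linarith
      then show ?thesis using supp supp' by (metis Un_iff add.right_neutral less_numeral_extra(3))
    qed
    then show ?thesis using noedge[of p q] noedge[of q p] eE by (auto simp: pq insert_commute)
  qed
  have "edeg N x \<le> a x" for x
  proof (cases "x \<in> H")
    case True
    then have "a' x = 0" using supp' disj by auto
    moreover have "edeg N x \<le> edeg M x" by (simp add: MN)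
    ultimately show ?thesis using M(2) by (metis add.right_neutral le_trans)
  next
    case False
    then show ?thesis using edeg_pos[of N x] by (auto simp: N_def)
  qed
  moreover have "set_mset N \<subseteq> E" using M(1) by (auto simp: N_def)
  ultimately have "size N \<le> T" by (intro packing_size[OF H(1)])
  have "edeg N' x \<le> a' x" for x
  proof (cases "x \<in> H'")
    case True
    then have "a x = 0" using supp disj by auto
    moreover have "edeg N' x \<le> edeg M x" by (simp add: MN)
    ultimately show ?thesis using M(2) by (metis add_0 le_trans)
  next
    case False
    then show ?thesis using edeg_pos[of N' x] side by (auto simp: N'_def)
  qed
  moreover have "set_mset N' \<subseteq> E" using M(1) by (auto simp: N'_def)
  ultimately have "size N' \<le> T'" by (intro packing_size[OF H'(1)])
  with \<open>size N \<le> T\<close> show "size M \<le> T + T'" by (simp add: MN)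
qed

text \<open>Split off unions of components until the set is connected, then use
  \<open>component_crit\<close>.\<close>

lemma packing_exists:
  fixes E :: "'v::finite set set"
  assumes E: "simple_graph E"
    and girth: "\<And>c. is_cycle E c \<Longrightarrow> odd (length c) \<Longrightarrow> 2 * k \<le> length c + 1"
    and col: "\<And>H L. adj_closed E W H \<Longrightarrow> H \<noteq> {} \<Longrightarrow> \<not> two_colouring E H L"
    and W: "W \<noteq> {}" "card (E \<inter> Pow W) \<le> T + k"
  shows "\<exists>a. packing E W T a"
  using col W
proof (induction "card W" arbitrary: W T rule: less_induct)
  case less
  note col = less.prems(1) and W = less.prems(2,3)
  show ?case
  proof (cases "conn E W")
    case True
    have "adj_closed E W W" by (simp add: adj_closed_def)
    then have "\<exists>a. crit E W a T" using component_crit[OF E True col girth W(2)] W(1) by blast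
    then show ?thesis using crit_packing[OF E] by blast
  next
    case False
    then obtain H where H: "adj_closed E W H" "H \<noteq> {}" "H \<noteq> W" using W(1) by (auto simp: conn_def)
    define H' where "H' = W - H"
    have HW: "H \<subseteq> W" using H(1) by (simp add: adj_closed_def)
    have H'W: "H' \<subseteq> W" "H' \<noteq> {}" "H' \<noteq> W" using HW H by (auto simp: H'_def)
    have noedge: "{u, w} \<notin> E" if "u \<in> H" "w \<in> H'" for u w
      using H(1) that by (auto simp: adj_closed_def H'_def)
    have "adj_closed E W H'"
      using noedge H'W(1) by (fastforce simp: adj_closed_def H'_def insert_commute)
    have trans: "adj_closed E W G" if "adj_closed E W F" "adj_closed E F G" for F G
      using that unfolding adj_closed_def by blast
    have cards: "card (E \<inter> Pow H) + card (E \<inter> Pow H') \<le> card (E \<inter> Pow W)"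
    proof -
      have "{} \<notin> E" using simple_graphD[OF E, of "{}"] by auto
      moreover have "e = {}" if "e \<subseteq> H" "e \<subseteq> H'" for e using that by (auto simp: H'_def)
      ultimately have "(E \<inter> Pow H) \<inter> (E \<inter> Pow H') = {}" by blast
      then have "card (E \<inter> Pow H) + card (E \<inter> Pow H') = card (E \<inter> Pow H \<union> E \<inter> Pow H')"
        by (intro card_Un_disjoint[symmetric]) auto
      also have "\<dots> \<le> card (E \<inter> Pow W)" using HW H'W by (intro card_mono) auto
      finally show ?thesis .
    qed
    \<comment> \<open>The least value allowed for \<open>H'\<close>, by truncated subtraction. The
      remainder \<open>T - T'\<close> suffices for \<open>H\<close> because the edge counts of both
      parts add up to at most that of \<open>W\<close>.\<close>
    define T' where "T' = card (E \<inter> Pow H') - k"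
    have "\<exists>a. packing E H' T' a"
    proof (rule less.hyps)
      show "card H' < card W" using H'W by (intro psubset_card_mono) auto
      show "\<not> two_colouring E G L" if "adj_closed E H' G" "G \<noteq> {}" for G L
        using col trans[OF \<open>adj_closed E W H'\<close> that(1)] that(2) by blast
    qed (use H'W in \<open>auto simp: T'_def\<close>)
    moreover have "\<exists>a. packing E H (T - T') a"
    proof (rule less.hyps)
      show "card H < card W" using HW H(3) by (intro psubset_card_mono) auto
      show "\<not> two_colouring E G L" if "adj_closed E H G" "G \<noteq> {}" for G L
        using col trans[OF H(1) that(1)] that(2) by blast
      show "card (E \<inter> Pow H) \<le> T - T' + k" using W(2) cards by (simp add: T'_def)
    qed (rule H)
    ultimately obtain a a' where "packing E H (T - T') a" "packing E H' T' a'" by blast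
    from packing_Un[OF E this(1) H(2) this(2) H'W(2) _ noedge]
    have "packing E (H \<union> H') (T - T' + T') (\<lambda>x. a x + a' x)" by (simp add: H'_def)
    moreover have "T' \<le> T" using W(2) cards by (simp add: T'_def)
    moreover have "H \<union> H' = W" using HW by (auto simp: H'_def)
    ultimately show ?thesis by auto
  qed
qed

text \<open>The witness has one extra unit at each vertex outside \<open>C\<close>. After raising a
  core vertex v, lower the packing at a neighbour u in the core and add the edge uv; after raising
  another vertex of \<open>C\<close>, add its edge to a vertex outside \<open>C\<close>.\<close>

lemma packing_witness:
  assumes E: "simple_graph E" and indep: "\<And>d d'. d \<notin> C \<Longrightarrow> d' \<notin> C \<Longrightarrow> {d, d'} \<notin> E"
    and pack: "packing E (core E C) T a" "core E C \<noteq> {}" and iso: "no_isolated E (core E C)"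
  shows "ass_witness E (Suc T) C (\<lambda>x. a x + of_bool (x \<notin> C))"
  unfolding ass_witness_def
proof (intro conjI ballI allI impI)
  fix v assume v: "v \<in> C"
  have "\<exists>b e. e \<in> E \<and> fits E T b \<and> (\<forall>x. b x + of_bool (x \<in> e) \<le> a x + of_bool (x \<notin> C) + of_bool (x = v))"
  proof (cases "v \<in> core E C")
    case True
    then obtain u where u: "u \<in> core E C" "{u, v} \<in> E" using iso by (auto simp: no_isolated_def)
    obtain b where b: "fits E T b" "\<And>x. b x + of_bool (x = u) \<le> a x"
      by (rule packingE[OF pack(1) u(1)]) (rule that)
    have "b x + of_bool (x \<in> {u, v}) \<le> a x + of_bool (x \<notin> C) + of_bool (x = v)" for x
      using b(2)[of x] by (auto simp: of_bool_def split: if_splits)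
    then show ?thesis using b(1) u(2) by blast
  next
    case False
    then obtain d where d: "d \<notin> C" "{v, d} \<in> E" using v by (auto simp: core_def)
    have "a x + of_bool (x \<in> {v, d}) \<le> a x + of_bool (x \<notin> C) + of_bool (x = v)" for x
      using d(1) v by auto
    then show ?thesis using d(2) packing_fits[OF pack] by blast
  qed
  then obtain b e where be: "e \<in> E" "fits E T b"
    "\<And>x. b x + of_bool (x \<in> e) \<le> a x + of_bool (x \<notin> C) + of_bool (x = v)" by auto
  have "fits E (T + 1) (\<lambda>x. b x + of_bool (x \<in> e))" by (rule fits_add[OF be(2) fits_one_edge[OF be(1)]])
  then show "fits E (Suc T) (\<lambda>x. a x + of_bool (x \<notin> C) + of_bool (x = v))"
    unfolding Suc_eq_plus1 by (rule fits_mono) (rule be(3))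
next
  fix b :: "'a \<Rightarrow> nat" assume b: "\<forall>v\<in>C. b v = 0"
  show "\<not> fits E (Suc T) (\<lambda>x. a x + of_bool (x \<notin> C) + b x)"
  proof
    assume "fits E (Suc T) (\<lambda>x. a x + of_bool (x \<notin> C) + b x)"
    then obtain M where M: "set_mset M \<subseteq> E" "size M = Suc T"
      "\<And>x. edeg M x \<le> a x + of_bool (x \<notin> C) + b x" by (auto simp: fits_def)
    have inC: "x \<in> core E C" if "x \<in> C" "0 < edeg M x" for x
    proof (rule ccontr)
      assume "x \<notin> core E C"
      then have "a x = 0" using pack(1) by (simp add: packing_def)
      then show False using M(3)[of x] b that by simp
    qed
    \<comment> \<open>An edge with an end outside \<open>C\<close> has its other end in
      \<open>C\<close> but not in the core, where the exponent is zero. So every packing lives on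
      the core and has at most \<open>T\<close> edges.\<close>
    have C: "x \<in> C" if x: "0 < edeg M x" for x
    proof (rule ccontr)
      assume "x \<notin> C"
      obtain e where e: "e \<in># M" "x \<in> e" using x by (auto simp: edeg_pos)
      then have eE: "e \<in> E" using M(1) by auto
      obtain y where y: "e = {x, y}" by (rule simple_edge[OF E eE e(2)])
      have "y \<in> C" using indep[of x y] \<open>x \<notin> C\<close> eE y by auto
      moreover have "0 < edeg M y" using e(1) y by (auto simp: edeg_pos)
      ultimately have "y \<in> core E C" by (rule inC)
      then show False using \<open>x \<notin> C\<close> eE y by (auto simp: core_def insert_commute)
    qed
    have "edeg M x \<le> a x" for x
      using C[of x] M(3)[of x] b by (cases "edeg M x = 0") auto
    with M(1) have "size M \<le> T" by (intro packing_size[OF pack(1)])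
    then show False using M(2) by simp
  qed
qed

text \<open>Here \<open>C\<close> is a minimal vertex cover, so the prime is a minimal prime of the
  edge ideal.\<close>

lemma minimal_cover_witness:
  assumes E: "simple_graph E" and indep: "\<And>d d'. d \<notin> C \<Longrightarrow> d' \<notin> C \<Longrightarrow> {d, d'} \<notin> E"
    and core: "core E C = {}" and C: "C \<noteq> {}"
  shows "\<exists>a. ass_witness E (Suc n) C a"
proof -
  have nbr: "\<exists>d. d \<notin> C \<and> {v, d} \<in> E" if "v \<in> C" for v
    using core that by (auto simp: core_def)
  obtain u where u: "u \<in> C" using C by auto
  from nbr[OF u] obtain d where d: "d \<notin> C" "{u, d} \<in> E" by auto
  \<comment> \<open>On \<open>C\<close> only \<open>u\<close> is positive, and every edge meets
    \<open>C\<close>, so at most \<open>n\<close> edges fit. The value \<open>Suc n\<close> outside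
    \<open>C\<close> leaves space for \<open>n\<close> copies of \<open>{u, d}\<close> and one edge
    \<open>{v, d'}\<close> even if \<open>d' = d\<close>.\<close>
  define a where "a x = (if x \<in> C then if x = u then n else 0 else Suc n)" for x
  have "fits E (Suc n) (\<lambda>x. a x + of_bool (x = v))" if v: "v \<in> C" for v
  proof -
    from nbr[OF v] obtain d' where d': "d' \<notin> C" "{v, d'} \<in> E" by auto
    show ?thesis
    proof (rule fitsI[of "add_mset {v, d'} (replicate_mset n {u, d})"])
      fix x
      show "edeg (add_mset {v, d'} (replicate_mset n {u, d})) x \<le> a x + of_bool (x = v)"
        using u d(1) v d'(1) by (auto simp: a_def)
    qed (use d(2) d'(2) in auto)
  qed
  moreover have "\<not> fits E (Suc n) (\<lambda>x. a x + b x)" if b: "\<forall>v\<in>C. b v = 0" for b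
  proof
    assume "fits E (Suc n) (\<lambda>x. a x + b x)"
    then obtain M where M: "set_mset M \<subseteq> E" "size M = Suc n" "\<And>x. edeg M x \<le> a x + b x"
      by (auto simp: fits_def)
    have "u \<in> e" if e: "e \<in># M" for e
    proof -
      have eE: "e \<in> E" using M(1) e by auto
      then obtain p q where "e = {p, q}" using simple_graphD[OF E] by (metis card_2_iff)
      then obtain x where x: "x \<in> e" "x \<in> C" using indep[of p q] eE by auto
      then have "0 < edeg M x" using e by (auto simp: edeg_pos)
      then have "x = u" using M(3)[of x] b x(2) by (auto simp: a_def split: if_splits)
      then show ?thesis using x(1) by simp
    qed
    then have "edeg M u = Suc n" using M(2) by (simp add: edeg_eq_size)
    then show False using M(3)[of u] b u by (simp add: a_def)
  qed
  ultimately show ?thesis unfolding ass_witness_def by blast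
qed

section \<open>Transfer of witnesses and the two bounds\<close>

lemma core_no_isolated:
  assumes E: "simple_graph E"
    and col: "\<And>H L. adj_closed E W H \<Longrightarrow> H \<noteq> {} \<Longrightarrow> \<not> two_colouring E H L"
  shows "no_isolated E W"
  unfolding no_isolated_def
proof (rule ballI, rule ccontr)
  fix v assume v: "v \<in> W" "\<not> (\<exists>u\<in>W. {u, v} \<in> E)"
  then have "adj_closed E W {v}" by (auto simp: adj_closed_def insert_commute)
  moreover have "{v} \<notin> E" using simple_graphD[OF E, of "{v}"] by auto
  then have "two_colouring E {v} {}" by (simp add: two_colouring_def)
  ultimately show False using col by blast
qed

text \<open>A witness for any exponent \<open>m\<close> yields the structure of \<open>C\<close>:
  independent complement and no bipartite component in the core. This alone produces witnesses for
  all exponents above \<open>card E - k\<close>.\<close>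

lemma witness_transfer:
  fixes E :: "'v::finite set set"
  assumes E: "simple_graph E" "E \<noteq> {}"
    and girth: "\<And>c. is_cycle E c \<Longrightarrow> odd (length c) \<Longrightarrow> 2 * k \<le> length c + 1"
    and wit: "ass_witness E m C a" and n: "card E \<le> n + k"
  shows "\<exists>a. ass_witness E (Suc n) C a"
proof -
  have indep: "{d, d'} \<notin> E" if "d \<notin> C" "d' \<notin> C" for d d'
    by (rule witness_independent[OF wit that])
  have col: "\<not> two_colouring E H L" if "adj_closed E (core E C) H" "H \<noteq> {}" for H L
    by (rule witness_not_two_colourable[OF E(1) wit that])
  show ?thesis
  proof (cases "core E C = {}")
    case True
    obtain e where e: "e \<in> E" using E(2) by auto
    then obtain p q where "e = {p, q}" using simple_graphD[OF E(1)] by (metis card_2_iff)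
    then have "C \<noteq> {}" using indep[of p q] e by auto
    then show ?thesis using minimal_cover_witness[OF E(1) indep True] by blast
  next
    case False
    have "card (E \<inter> Pow (core E C)) \<le> card E" by (intro card_mono) auto
    then have "card (E \<inter> Pow (core E C)) \<le> n + k" using n by simp
    from packing_exists[OF E(1) girth col False this]
    obtain a where "packing E (core E C) n a" by blast
    from packing_witness[OF E(1) indep this False core_no_isolated[OF E(1) col]]
    show ?thesis by blast
  qed
qed

lemma not_bipartite_not_two_colourable:
  assumes "simple_graph E" "\<not> bipartite E"
  shows "\<not> two_colouring E UNIV L"
proof
  assume L: "two_colouring E UNIV L"
  have "\<exists>a\<in>L. \<exists>b\<in>-L. e = {a, b}" if e: "e \<in> E" for e
  proof -
    obtain p q where pq: "e = {p, q}" using simple_graphD[OF assms(1) e] by (metis card_2_iff)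
    then have "p \<in> L \<longleftrightarrow> q \<notin> L" using L e by (auto simp: two_colouring_def)
    then show ?thesis using pq by (cases "p \<in> L") auto
  qed
  then show False using assms(2) unfolding bipartite_def by (elim notE) (intro exI[of _ L] exI[of _ "- L"], auto)
qed

theorem mainTheorem4:
  fixes E :: "'v::finite set set"
  assumes "simple_graph E"
    and "connected_graph E"
    and "\<not> bipartite E"
  shows "ereal_of_enat (dstab (edge_ideal E :: ('v, 'k::field) mpoly set))
           \<le> ereal (1 / 2 * (real (card E) + real (num_bridges E)) + 1)
       \<and> (\<forall>k::nat. int (odd_girth E) = 2 * int k - 1 \<longrightarrow>
            ereal_of_enat (astab (edge_ideal E :: ('v, 'k::field) mpoly set))
              \<le> ereal (real (card E) - real k + 1))"
proof (intro conjI allI impI)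
  let ?I = "edge_ideal E :: ('v, 'k) mpoly set"
  note E = assms(1)
  have col: "\<not> two_colouring E UNIV L" for L
    by (rule not_bipartite_not_two_colourable[OF E assms(3)])
  have conn: "conn E UNIV" by (rule connected_graph_conn[OF assms(2)])
  obtain a T where crit: "crit E UNIV a T" and T: "2 * T \<le> card E + num_bridges E"
    and iso: "no_isolated E UNIV" using spanning_crit[OF E assms(2) col] by blast
  have core: "core E UNIV = UNIV" by (simp add: core_def)
  \<comment> \<open>For the maximal ideal \<open>C\<close> is everything and so is its core; the
    spanning critical vector is then a witness for exponent T + 1.\<close>
  have "ass_witness E (Suc T) UNIV (\<lambda>x. a x + of_bool (x \<notin> UNIV))"
    by (rule packing_witness[OF E]) (use crit_packing[OF E crit] iso core in auto)
  then have "max_ideal \<in> Ass mpoly_ring (ideal_pow mpoly_ring ?I (Suc T))"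
    unfolding Ass_power_iff[OF E] var_ideal_UNIV[symmetric] by blast
  then have "dstab ?I \<le> enat (Suc T)"
    unfolding dstab_def by (intro Inf_lower) auto
  then have "ereal_of_enat (dstab ?I) \<le> ereal_of_enat (enat (Suc T))"
    by (simp only: ereal_of_enat_le_iff)
  also have "\<dots> \<le> ereal (1 / 2 * (real (card E) + real (num_bridges E)) + 1)"
    using T by simp
  finally show "ereal_of_enat (dstab ?I) \<le> ereal (1 / 2 * (real (card E) + real (num_bridges E)) + 1)" .
next
  let ?I = "edge_ideal E :: ('v, 'k) mpoly set"
  note E = assms(1)
  fix k :: nat assume k: "int (odd_girth E) = 2 * int k - 1"
  have col: "\<not> two_colouring E UNIV L" for L
    by (rule not_bipartite_not_two_colourable[OF E assms(3)])
  have conn: "conn E UNIV" by (rule connected_graph_conn[OF assms(2)])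
  have girth: "2 * k \<le> length c + 1" if "is_cycle E c" "odd (length c)" for c
  proof -
    have "odd_girth E \<le> length c" unfolding odd_girth_def by (rule Least_le) (use that in blast)
    then show ?thesis using k by linarith
  qed
  obtain c where c: "is_cycle E c" "odd (length c)" "path_edges (c @ [hd c]) \<subseteq> E"
    by (rule odd_cycle_exists[OF E conn col])
  have "card (path_edges (c @ [hd c])) \<le> card E" using c(3) by (intro card_mono) auto
  then have len: "length c \<le> card E" "3 \<le> length c"
    using c(1) card_cycle_edges[of c] by (auto simp: is_cycle_def)
  \<comment> \<open>This makes the natural subtraction in \<open>N\<close> agree with the real one
    in the bound.\<close>
  then have kE: "k \<le> card E" "E \<noteq> {}" using girth[OF c(1,2)] by auto
  define N where "N = card E - k"
  \<comment> \<open>The exponent \<open>m\<close> is arbitrary, so the inclusion holds in both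
    directions between any two powers from \<open>Suc N\<close> on.\<close>
  have mono: "Ass mpoly_ring (ideal_pow mpoly_ring ?I m) \<subseteq> Ass mpoly_ring (ideal_pow mpoly_ring ?I (Suc n))"
    if "N \<le> n" for m n
    using witness_transfer[OF E kE(2) girth, of m _ _ n] that
    unfolding Ass_power_iff[OF E] subset_iff N_def by auto
  have "Ass mpoly_ring (ideal_pow mpoly_ring ?I (Suc N)) = Ass mpoly_ring (ideal_pow mpoly_ring ?I (Suc N + i))" for i
    using mono[of "N + i" "Suc N"] mono[of N "Suc N + i"] by auto
  then have "astab ?I \<le> enat (Suc N)"
    unfolding astab_def by (intro Inf_lower) auto
  then have "ereal_of_enat (astab ?I) \<le> ereal_of_enat (enat (Suc N))"
    by (simp only: ereal_of_enat_le_iff)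
  also have "\<dots> = ereal (real (card E) - real k + 1)"
    using kE(1) by (simp add: N_def of_nat_diff)
  finally show "ereal_of_enat (astab ?I) \<le> ereal (real (card E) - real k + 1)" .
qed

end
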